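(* Let $\mathbf S$ be a super Fermat theory with ground ring $\mathbb K$, let $A$ be a near-point determined $\mathbf S$-algebra and let $M$ be a free super $A$-module. Then every $\mathbb K$-algebra derivation of $A_\sharp$ with values in $M$ is an $\mathbf S$-algebra derivation of $A$ with values in $M$.
   Context: All rings contain $\mathbb Q$; "super" means $\mathbb Z_2$-graded. Super Fermat theories. $\mathbf{SCom}$ is the two-sorted Lawvere theory of supercommutative $\mathbb Q$-superalgebras. A super Fermat theory is a two-sorted Lawvere theory $\mathbf S$ (objects $(m|n)$, products of $m$ copies of the even sort $(1|0)$ and $n$ copies of the odd sort $(0|1)$) with a morphism of theories $\mathbf{SCom}\to\mathbf S$. $\mathbf S$-algebras are finite-product-preserving functors $\mathbf S\to\mathbf{Set}$. The free $\mathbf S$-algebra on $m$ even and $n$ odd generators is $\mathbf S(m|n)=\mathbb K\{x_1,\dots,x_m;\xi_1,\dots,\xi_n\}$, $\mathbb K=\mathbf S(0|0)$; $A_\sharp$ denotes the underlying supercommutative $\mathbb K$-algebra of an $\mathbf S$-algebra $A$. Required: (i) each $f\in\mathbb K\{x,z;\zeta\}$ has a unique $g\in\mathbb K\{x,y,z;\zeta\}$ with $f(x,z;\zeta)-f(y,z;\zeta)=(x-y)g(x,y,z;\zeta)$; (ii) each $f\in\mathbb K\{z;\xi,\zeta\}$ has a unique $h\in\mathbb K\{z;\zeta\}$ with $f(z;\theta,\zeta)-f(z;\eta,\zeta)=(\theta-\eta)h(z;\zeta)$ ($z,\zeta$ finite tuples of even/odd variables). Put $\frac{\partial f}{\partial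 x}=g(x,x,z;\zeta)$, $\frac{\partial f}{\partial\xi}=h$. For $f\in\mathbf S(m|n)$, even $a^1,\dots,a^m$ and odd $b^1,\dots,b^n$ in $A$, $A(f)(\mathbf a,\mathbf b)\in A$ is the value of the operation $f$. A super $A$-module is a super module over $A_\sharp$, regarded as a bimodule via the Koszul sign rule; it is free if it is a direct sum of copies of $A$ and of its parity shift $\Pi A$ (possibly infinitely many). A $\mathbb K$-algebra derivation $A_\sharp\to M$ is a (parity-preserving) $\mathbb K$-linear $D$ with $D(ab)=aD(b)+D(a)b$. The square-zero extension $M[\epsilon]=A\oplus M$ is the $\mathbf S$-algebra with operations $$M[\epsilon](f)(\mathbf a+\epsilon\mathbf u,\mathbf b+\epsilon\mathbf v)=A(f)(\mathbf a,\mathbf b)+\epsilon\Big(\sum_iu^iA\big(\tfrac{\partial f}{\partial x_i}\big)(\mathbf a,\mathbf b)+\sum_jv^jA\big(\tfrac{\partial f}{\partial\xi_j}\big)(\mathbf a,\mathbf b)\Big),$$ and an $\mathbf S$-algebra derivation with values in $M$ is a map $D$ such that $a\mapsto a+\epsilon D(a)$ is an $\mathbf S$-algebra section of the projection $M[\epsilon]\to A$. A Weil $\mathbb K$-algebra is a supercommutative $\mathbb K$-algebra $W$, finitely generated as a $\mathbb K$-module, with a $\mathbb K$-algebra homomorphism $W\to\mathbb K$ with nilpotent kernel; it carries a unique $\mathbf S$-algebra structure compatible with that of $\mathbb K$. An $\mathbf S$-algebra $A$ is near-point determined if any two distinct elements of $A$ are separated by some $\mathbf S$-algebra homomorphism from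 $A$ to a Weil $\mathbb K$-algebra. *)

theory Defs
  imports Complex_Main "HOL-Algebra.Ring" "HOL-Library.Z2"
begin

section \<open>Two-sorted Lawvere theories and their algebras\<close>

text \<open>
  Parities are elements of \<^typ>\<open>bit\<close>: 0 is even, 1 is odd.  The object (m|n) is the function \<open>X\<close>
  with \<open>X 0 = m\<close> and \<open>X 1 = n\<close>.  The variables of \<open>X\<close> are the pairs \<open>(p, i)\<close> with \<open>i < X p\<close>.
\<close>

type_synonym sdim = "bit \<Rightarrow> nat"

definition sobj :: "bit \<Rightarrow> sdim" where
  "sobj p = (\<lambda>q. if q = p then 1 else 0)"

definition zobj :: sdim where
  "zobj = (\<lambda>_. 0)"

definition padd :: "sdim \<Rightarrow> sdim \<Rightarrow> sdim" where
  "padd X Y = (\<lambda>p. X p + Y p)"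

record 'f law_theory =
  arr :: "'f set"
  src :: "'f \<Rightarrow> sdim"
  tgt :: "'f \<Rightarrow> sdim"
  idn :: "sdim \<Rightarrow> 'f"
  cmp :: "'f \<Rightarrow> 'f \<Rightarrow> 'f"  \<comment> \<open>\<open>cmp T g f\<close> is g after f\<close>
  prj :: "sdim \<Rightarrow> bit \<Rightarrow> nat \<Rightarrow> 'f"

definition Hom :: "('f, 'z) law_theory_scheme \<Rightarrow> sdim \<Rightarrow> sdim \<Rightarrow> 'f set" where
  "Hom T X Y = {f \<in> arr T. src T f = X \<and> tgt T f = Y}"

text \<open>
  A category with objects \<^typ>\<open>sdim\<close> in which every \<open>X\<close> is, via \<open>prj T X\<close>, the product of \<open>X 0\<close> copies
  of (1|0) and \<open>X 1\<close> copies of (0|1).  The projection of a sort onto itself is the identity.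
\<close>

definition lawvere_theory :: "('f, 'z) law_theory_scheme \<Rightarrow> bool" where
  "lawvere_theory T \<longleftrightarrow>
     (\<forall>X. idn T X \<in> Hom T X X) \<and>
     (\<forall>X Y Z. \<forall>f\<in>Hom T X Y. \<forall>g\<in>Hom T Y Z. cmp T g f \<in> Hom T X Z) \<and>
     (\<forall>X Y. \<forall>f\<in>Hom T X Y. cmp T f (idn T X) = f \<and> cmp T (idn T Y) f = f) \<and>
     (\<forall>W X Y Z. \<forall>f\<in>Hom T W X. \<forall>g\<in>Hom T X Y. \<forall>h\<in>Hom T Y Z.
        cmp T h (cmp T g f) = cmp T (cmp T h g) f) \<and>
     (\<forall>X p i. i < X p \<longrightarrow> prj T X p i \<in> Hom T X (sobj p)) \<and>
     (\<forall>p. prj T (sobj p) p 0 = idn T (sobj p)) \<and>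
     (\<forall>X Y c. (\<forall>p i. i < X p \<longrightarrow> c p i \<in> Hom T Y (sobj p)) \<longrightarrow>
        (\<exists>!f. f \<in> Hom T Y X \<and> (\<forall>p i. i < X p \<longrightarrow> cmp T (prj T X p i) f = c p i)))"

definition theory_morphism ::
  "('e, 'y) law_theory_scheme \<Rightarrow> ('f, 'z) law_theory_scheme \<Rightarrow> ('e \<Rightarrow> 'f) \<Rightarrow> bool" where
  "theory_morphism T T' F \<longleftrightarrow>
     (\<forall>X Y. \<forall>f\<in>Hom T X Y. F f \<in> Hom T' X Y) \<and>
     (\<forall>X. F (idn T X) = idn T' X) \<and>
     (\<forall>X Y Z. \<forall>f\<in>Hom T X Y. \<forall>g\<in>Hom T Y Z. F (cmp T g f) = cmp T' (F g) (F f)) \<and>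
     (\<forall>X p i. i < X p \<longrightarrow> F (prj T X p i) = prj T' X p i)"

text \<open>
  An algebra is a functor to sets: \<open>ob A X\<close> is the value at the object \<open>X\<close>, and \<open>mor A f\<close> the value at
  the arrow \<open>f\<close>.  The even and odd elements of \<open>A\<close> are those of \<open>ob A (sobj 0)\<close> and \<open>ob A (sobj 1)\<close>.
\<close>

record ('f, 'a) salg =
  ob :: "sdim \<Rightarrow> 'a set"
  mor :: "'f \<Rightarrow> 'a \<Rightarrow> 'a"

definition s_algebra :: "('f, 'z) law_theory_scheme \<Rightarrow> ('f, 'a) salg \<Rightarrow> bool" where
  "s_algebra T A \<longleftrightarrow>
     (\<forall>X Y. \<forall>f\<in>Hom T X Y. \<forall>a\<in>ob A X. mor A f a \<in> ob A Y) \<and>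
     (\<forall>X. \<forall>a\<in>ob A X. mor A (idn T X) a = a) \<and>
     (\<forall>X Y Z. \<forall>f\<in>Hom T X Y. \<forall>g\<in>Hom T Y Z. \<forall>a\<in>ob A X. mor A (cmp T g f) a = mor A g (mor A f a)) \<and>
     (\<forall>X c. (\<forall>p i. i < X p \<longrightarrow> c p i \<in> ob A (sobj p)) \<longrightarrow>
        (\<exists>!a. a \<in> ob A X \<and> (\<forall>p i. i < X p \<longrightarrow> mor A (prj T X p i) a = c p i)))"

definition salg_hom ::
  "('f, 'z) law_theory_scheme \<Rightarrow> ('f, 'a) salg \<Rightarrow> ('f, 'b) salg \<Rightarrow> (sdim \<Rightarrow> 'a \<Rightarrow> 'b) \<Rightarrow> bool" where
  "salg_hom T A B h \<longleftrightarrow>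
     (\<forall>X. \<forall>a\<in>ob A X. h X a \<in> ob B X) \<and>
     (\<forall>X Y. \<forall>f\<in>Hom T X Y. \<forall>a\<in>ob A X. h Y (mor A f a) = mor B f (h X a))"

definition free_salg :: "('f, 'z) law_theory_scheme \<Rightarrow> sdim \<Rightarrow> ('f, 'f) salg" where
  "free_salg T X = \<lparr>ob = (\<lambda>Y. Hom T X Y), mor = cmp T\<rparr>"

text \<open>
  \<open>tup T A X c\<close> is the element of \<open>A(X)\<close> with components \<open>c\<close>, and \<open>app T A f c\<close> is the value A(f)(c).
  In the free algebra \<open>free_salg T Y\<close>, \<open>app\<close> is substitution: \<open>c p i\<close> is put for the variable \<open>(p, i)\<close> of \<open>f\<close>.
\<close>

definition tup :: "('f, 'z) law_theory_scheme \<Rightarrow> ('f, 'a) salg \<Rightarrow> sdim \<Rightarrow> (bit \<Rightarrow> nat \<Rightarrow> 'a) \<Rightarrow> 'a" where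
  "tup T A X c = (THE a. a \<in> ob A X \<and> (\<forall>p i. i < X p \<longrightarrow> mor A (prj T X p i) a = c p i))"

definition app :: "('f, 'z) law_theory_scheme \<Rightarrow> ('f, 'a) salg \<Rightarrow> 'f \<Rightarrow> (bit \<Rightarrow> nat \<Rightarrow> 'a) \<Rightarrow> 'a" where
  "app T A f c = mor A f (tup T A (src T f) c)"


section \<open>The theory of supercommutative superalgebras over the rationals\<close>

text \<open>
  An arrow from \<open>X\<close> to \<open>Y\<close> is a tuple of \<open>Y 0\<close> even and \<open>Y 1\<close> odd classes of terms in the variables \<open>X\<close>,
  modulo the equations provable from the axioms of supercommutative Q-superalgebras.
\<close>

datatype sterm =
    TVar bit nat
  | TZero bit
  | TOne
  | TNeg sterm
  | TAdd sterm sterm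
  | TScal rat sterm
  | TMul sterm sterm

inductive wt :: "sdim \<Rightarrow> bit \<Rightarrow> sterm \<Rightarrow> bool" for X :: sdim where
  "i < X p \<Longrightarrow> wt X p (TVar p i)"
| "wt X p (TZero p)"
| "wt X 0 TOne"
| "wt X p t \<Longrightarrow> wt X p (TNeg t)"
| "wt X p s \<Longrightarrow> wt X p t \<Longrightarrow> wt X p (TAdd s t)"
| "wt X p t \<Longrightarrow> wt X p (TScal r t)"
| "wt X p s \<Longrightarrow> wt X q t \<Longrightarrow> wt X (p + q) (TMul s t)"

inductive teq :: "sdim \<Rightarrow> bit \<Rightarrow> sterm \<Rightarrow> sterm \<Rightarrow> bool" for X :: sdim where
  refl: "wt X p t \<Longrightarrow> teq X p t t"
| sym: "teq X p s t \<Longrightarrow> teq X p t s"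
| trans: "teq X p s t \<Longrightarrow> teq X p t u \<Longrightarrow> teq X p s u"
| neg_cong: "teq X p s t \<Longrightarrow> teq X p (TNeg s) (TNeg t)"
| add_cong: "teq X p s s' \<Longrightarrow> teq X p t t' \<Longrightarrow> teq X p (TAdd s t) (TAdd s' t')"
| scal_cong: "teq X p s t \<Longrightarrow> teq X p (TScal r s) (TScal r t)"
| mul_cong: "teq X p s s' \<Longrightarrow> teq X q t t' \<Longrightarrow> teq X (p + q) (TMul s t) (TMul s' t')"
| add_assoc: "wt X p s \<Longrightarrow> wt X p t \<Longrightarrow> wt X p u \<Longrightarrow>
    teq X p (TAdd (TAdd s t) u) (TAdd s (TAdd t u))"
| add_comm: "wt X p s \<Longrightarrow> wt X p t \<Longrightarrow> teq X p (TAdd s t) (TAdd t s)"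
| add_zero: "wt X p t \<Longrightarrow> teq X p (TAdd (TZero p) t) t"
| add_neg: "wt X p t \<Longrightarrow> teq X p (TAdd (TNeg t) t) (TZero p)"
| scal_one: "wt X p t \<Longrightarrow> teq X p (TScal 1 t) t"
| scal_scal: "wt X p t \<Longrightarrow> teq X p (TScal r (TScal r' t)) (TScal (r * r') t)"
| scal_add: "wt X p s \<Longrightarrow> wt X p t \<Longrightarrow> teq X p (TScal r (TAdd s t)) (TAdd (TScal r s) (TScal r t))"
| add_scal: "wt X p t \<Longrightarrow> teq X p (TScal (r + r') t) (TAdd (TScal r t) (TScal r' t))"
| mul_assoc: "wt X p s \<Longrightarrow> wt X q t \<Longrightarrow> wt X r u \<Longrightarrow>
    teq X (p + q + r) (TMul (TMul s t) u) (TMul s (TMul t u))"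
| mul_one: "wt X p t \<Longrightarrow> teq X p (TMul TOne t) t"
| mul_add: "wt X p s \<Longrightarrow> wt X q t \<Longrightarrow> wt X q u \<Longrightarrow>
    teq X (p + q) (TMul s (TAdd t u)) (TAdd (TMul s t) (TMul s u))"
| mul_scal: "wt X p s \<Longrightarrow> wt X q t \<Longrightarrow> teq X (p + q) (TMul (TScal r s) t) (TScal r (TMul s t))"
| mul_comm: "wt X p s \<Longrightarrow> wt X q t \<Longrightarrow> p * q = 0 \<Longrightarrow> teq X (p + q) (TMul s t) (TMul t s)"
| mul_anticomm: "wt X 1 s \<Longrightarrow> wt X 1 t \<Longrightarrow> teq X 0 (TMul s t) (TNeg (TMul t s))"

definition tclass :: "sdim \<Rightarrow> bit \<Rightarrow> sterm \<Rightarrow> sterm set" where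
  "tclass X p t = {u. teq X p t u}"

primrec tsubst :: "(bit \<Rightarrow> nat \<Rightarrow> sterm) \<Rightarrow> sterm \<Rightarrow> sterm" where
  "tsubst \<sigma> (TVar p i) = \<sigma> p i"
| "tsubst \<sigma> (TZero p) = TZero p"
| "tsubst \<sigma> TOne = TOne"
| "tsubst \<sigma> (TNeg t) = TNeg (tsubst \<sigma> t)"
| "tsubst \<sigma> (TAdd s t) = TAdd (tsubst \<sigma> s) (tsubst \<sigma> t)"
| "tsubst \<sigma> (TScal r t) = TScal r (tsubst \<sigma> t)"
| "tsubst \<sigma> (TMul s t) = TMul (tsubst \<sigma> s) (tsubst \<sigma> t)"

type_synonym scom_arr = "sdim \<times> (bit \<Rightarrow> sterm set list)"

text \<open>Composition substitutes representatives of the classes.\<close>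

definition SCom :: "scom_arr law_theory" where
  "SCom = \<lparr>
     arr = {(X, cs). \<forall>p. set (cs p) \<subseteq> {tclass X p t | t. wt X p t}},
     src = fst,
     tgt = (\<lambda>f p. length (snd f p)),
     idn = (\<lambda>X. (X, \<lambda>p. map (\<lambda>i. tclass X p (TVar p i)) [0..<X p])),
     cmp = (\<lambda>g f. (fst f, \<lambda>p. map (\<lambda>d. {u. \<exists>t\<in>d. \<exists>\<sigma>.
               (\<forall>q i. i < fst g q \<longrightarrow> \<sigma> q i \<in> snd f q ! i) \<and> teq (fst f) p (tsubst \<sigma> t) u}) (snd g p))),
     prj = (\<lambda>X p i. (X, \<lambda>q. if q = p then [tclass X p (TVar p i)] else []))\<rparr>"

definition scom_op :: "sdim \<Rightarrow> bit \<Rightarrow> sterm \<Rightarrow> scom_arr" where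
  "scom_op X p t = (X, \<lambda>q. if q = p then [tclass X p t] else [])"


section \<open>Superalgebras and supermodules\<close>

text \<open>
  Graded objects are given by their homogeneous components.  Of each \<open>part M p\<close> only the additive
  structure is used.  \<open>act M p q a m\<close> is the product of \<open>a\<close> of parity \<open>p\<close> and \<open>m\<close> of parity \<open>q\<close>.
  A superring is a module over itself together with a unit, and a superalgebra over \<open>K\<close> has in
  addition the structure map \<open>cst\<close> from \<open>K\<close>.
\<close>

record ('a, 'm) super_module =
  part :: "bit \<Rightarrow> 'm ring"
  act :: "bit \<Rightarrow> bit \<Rightarrow> 'a \<Rightarrow> 'm \<Rightarrow> 'm"

record 'a super_ring = "('a, 'a) super_module" +
  unt :: 'a

record ('k, 'a) super_alg = "'a super_ring" +
  cst :: "bit \<Rightarrow> 'k \<Rightarrow> 'a"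

text \<open>\<open>ksign G r x\<close> is x multiplied with the sign (-1)^r.\<close>

definition ksign :: "'m ring \<Rightarrow> bit \<Rightarrow> 'm \<Rightarrow> 'm" where
  "ksign G r x = (if r = 1 then \<ominus>\<^bsub>G\<^esub> x else x)"

definition is_super_module ::
  "('a, 'y) super_ring_scheme \<Rightarrow> ('a, 'm, 'z) super_module_scheme \<Rightarrow> bool" where
  "is_super_module B M \<longleftrightarrow>
     (\<forall>p. abelian_group (part M p)) \<and>
     (\<forall>p q. \<forall>a\<in>carrier (part B p). \<forall>m\<in>carrier (part M q). act M p q a m \<in> carrier (part M (p + q))) \<and>
     (\<forall>p q. \<forall>a\<in>carrier (part B p). \<forall>m\<in>carrier (part M q). \<forall>n\<in>carrier (part M q).
        act M p q a (m \<oplus>\<^bsub>part M q\<^esub> n) = act M p q a m \<oplus>\<^bsub>part M (p + q)\<^esub> act M p q a n) \<and>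
     (\<forall>p q. \<forall>a\<in>carrier (part B p). \<forall>b\<in>carrier (part B p). \<forall>m\<in>carrier (part M q).
        act M p q (a \<oplus>\<^bsub>part B p\<^esub> b) m = act M p q a m \<oplus>\<^bsub>part M (p + q)\<^esub> act M p q b m) \<and>
     (\<forall>p q r. \<forall>a\<in>carrier (part B p). \<forall>b\<in>carrier (part B q). \<forall>m\<in>carrier (part M r).
        act M (p + q) r (act B p q a b) m = act M p (q + r) a (act M q r b m)) \<and>
     (\<forall>q. \<forall>m\<in>carrier (part M q). act M 0 q (unt B) m = m)"

definition is_super_comm_ring :: "('a, 'y) super_ring_scheme \<Rightarrow> bool" where
  "is_super_comm_ring B \<longleftrightarrow>
     is_super_module B B \<and>
     unt B \<in> carrier (part B 0) \<and>
     (\<forall>p q. \<forall>a\<in>carrier (part B p). \<forall>b\<in>carrier (part B q).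
        act B p q a b = ksign (part B (p + q)) (p * q) (act B q p b a))"

definition is_super_ring_hom ::
  "('a, 'y) super_ring_scheme \<Rightarrow> ('b, 'z) super_ring_scheme \<Rightarrow> (bit \<Rightarrow> 'a \<Rightarrow> 'b) \<Rightarrow> bool" where
  "is_super_ring_hom B C h \<longleftrightarrow>
     (\<forall>p. \<forall>a\<in>carrier (part B p). h p a \<in> carrier (part C p)) \<and>
     (\<forall>p. \<forall>a\<in>carrier (part B p). \<forall>b\<in>carrier (part B p).
        h p (a \<oplus>\<^bsub>part B p\<^esub> b) = h p a \<oplus>\<^bsub>part C p\<^esub> h p b) \<and>
     (\<forall>p q. \<forall>a\<in>carrier (part B p). \<forall>b\<in>carrier (part B q).
        h (p + q) (act B p q a b) = act C p q (h p a) (h q b)) \<and>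
     h 0 (unt B) = unt C"

definition is_super_comm_alg ::
  "('k, 'y) super_ring_scheme \<Rightarrow> ('k, 'a, 'z) super_alg_scheme \<Rightarrow> bool" where
  "is_super_comm_alg K B \<longleftrightarrow> is_super_comm_ring B \<and> is_super_ring_hom K B (cst B)"

definition is_super_alg_hom ::
  "('k, 'x) super_ring_scheme \<Rightarrow> ('k, 'a, 'y) super_alg_scheme \<Rightarrow> ('k, 'b, 'z) super_alg_scheme \<Rightarrow>
   (bit \<Rightarrow> 'a \<Rightarrow> 'b) \<Rightarrow> bool" where
  "is_super_alg_hom K B C h \<longleftrightarrow> is_super_ring_hom B C h \<and>
     (\<forall>p. \<forall>k\<in>carrier (part K p). h p (cst B p k) = cst C p k)"

text \<open>The right action given by the Koszul sign rule, for \<open>m\<close> of parity \<open>p\<close> and \<open>a\<close> of parity \<open>q\<close>.\<close>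

definition ract :: "('a, 'm, 'z) super_module_scheme \<Rightarrow> bit \<Rightarrow> bit \<Rightarrow> 'm \<Rightarrow> 'a \<Rightarrow> 'm" where
  "ract M p q m a = ksign (part M (p + q)) (p * q) (act M q p a m)"

definition regular_module :: "('a, 'z) super_ring_scheme \<Rightarrow> ('a, 'a) super_module" where
  "regular_module B = \<lparr>part = part B, act = act B\<rparr>"

definition parity_shift :: "('a, 'm) super_module \<Rightarrow> ('a, 'm) super_module" where
  "parity_shift M = \<lparr>
     part = (\<lambda>p. part M (p + 1)),
     act = (\<lambda>p q a m. ksign (part M (p + q + 1)) p (act M p (q + 1) a m))\<rparr>"

definition direct_sum :: "'i set \<Rightarrow> ('i \<Rightarrow> ('a, 'm) super_module) \<Rightarrow> ('a, 'i \<Rightarrow> 'm) super_module" where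
  "direct_sum I N = \<lparr>
     part = (\<lambda>p. \<lparr>
       carrier = {x \<in> \<Pi>\<^sub>E i\<in>I. carrier (part (N i) p). finite {i \<in> I. x i \<noteq> \<zero>\<^bsub>part (N i) p\<^esub>}},
       mult = undefined, one = undefined,
       zero = (\<lambda>i\<in>I. \<zero>\<^bsub>part (N i) p\<^esub>),
       add = (\<lambda>x y. \<lambda>i\<in>I. x i \<oplus>\<^bsub>part (N i) p\<^esub> y i)\<rparr>),
     act = (\<lambda>p q a x. \<lambda>i\<in>I. act (N i) p q a (x i))\<rparr>"

definition super_module_iso ::
  "('a, 'y) super_ring_scheme \<Rightarrow> ('a, 'm) super_module \<Rightarrow> ('a, 'n) super_module \<Rightarrow>
   (bit \<Rightarrow> 'm \<Rightarrow> 'n) \<Rightarrow> bool" where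
  "super_module_iso B M N h \<longleftrightarrow>
     (\<forall>p. bij_betw (h p) (carrier (part M p)) (carrier (part N p))) \<and>
     (\<forall>p. \<forall>m\<in>carrier (part M p). \<forall>n\<in>carrier (part M p).
        h p (m \<oplus>\<^bsub>part M p\<^esub> n) = h p m \<oplus>\<^bsub>part N p\<^esub> h p n) \<and>
     (\<forall>p q. \<forall>a\<in>carrier (part B p). \<forall>m\<in>carrier (part M q).
        h (p + q) (act M p q a m) = act N p q a (h q m))"

text \<open>\<open>M\<close> is the direct sum over \<open>I\<close> of copies of \<open>B\<close> (where \<open>s i = 0\<close>) and of its shift (where \<open>s i = 1\<close>).\<close>

definition free_super_module ::
  "('a, 'y) super_ring_scheme \<Rightarrow> ('a, 'm) super_module \<Rightarrow> 'i set \<Rightarrow> ('i \<Rightarrow> bit) \<Rightarrow> bool" where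
  "free_super_module B M I s \<longleftrightarrow>
     is_super_module B M \<and>
     (\<exists>h. super_module_iso B M
        (direct_sum I (\<lambda>i. if s i = 0 then regular_module B else parity_shift (regular_module B))) h)"

definition alg_derivation ::
  "('k, 'y) super_ring_scheme \<Rightarrow> ('k, 'a, 'z) super_alg_scheme \<Rightarrow> ('a, 'm) super_module \<Rightarrow>
   (bit \<Rightarrow> 'a \<Rightarrow> 'm) \<Rightarrow> bool" where
  "alg_derivation K B M D \<longleftrightarrow>
     (\<forall>p. \<forall>a\<in>carrier (part B p). D p a \<in> carrier (part M p)) \<and>
     (\<forall>p. \<forall>a\<in>carrier (part B p). \<forall>b\<in>carrier (part B p).
        D p (a \<oplus>\<^bsub>part B p\<^esub> b) = D p a \<oplus>\<^bsub>part M p\<^esub> D p b) \<and>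
     (\<forall>p q. \<forall>k\<in>carrier (part K p). \<forall>a\<in>carrier (part B q).
        D (p + q) (act B p q (cst B p k) a) = act M p q (cst B p k) (D q a)) \<and>
     (\<forall>p q. \<forall>a\<in>carrier (part B p). \<forall>b\<in>carrier (part B q).
        D (p + q) (act B p q a b) = act M p q a (D q b) \<oplus>\<^bsub>part M (p + q)\<^esub> ract M p q (D p a) b)"

text \<open>The product of a list of homogeneous elements, each paired with its parity.\<close>

fun sprod :: "('a, 'z) super_ring_scheme \<Rightarrow> (bit \<times> 'a) list \<Rightarrow> bit \<times> 'a" where
  "sprod B [] = (0, unt B)"
| "sprod B ((p, a) # xs) = (p + fst (sprod B xs), act B p (fst (sprod B xs)) a (snd (sprod B xs)))"

definition fin_gen_over :: "('k, 'y) super_ring_scheme \<Rightarrow> ('k, 'a, 'z) super_alg_scheme \<Rightarrow> bool" where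
  "fin_gen_over K B \<longleftrightarrow>
     (\<exists>G. finite G \<and> (\<forall>(q, g)\<in>G. g \<in> carrier (part B q)) \<and>
        (\<forall>p. \<forall>w\<in>carrier (part B p). \<exists>k. (\<forall>(q, g)\<in>G. k (q, g) \<in> carrier (part K (p + q))) \<and>
           w = finsum (part B p) (\<lambda>(q, g). act B (p + q) q (cst B (p + q) (k (q, g))) g) G))"

definition nilpotent_kernel ::
  "('a, 'y) super_ring_scheme \<Rightarrow> ('b, 'z) super_ring_scheme \<Rightarrow> (bit \<Rightarrow> 'a \<Rightarrow> 'b) \<Rightarrow> bool" where
  "nilpotent_kernel B C h \<longleftrightarrow>
     (\<exists>N. \<forall>xs. length xs = N \<and>
        (\<forall>(p, a)\<in>set xs. a \<in> carrier (part B p) \<and> h p a = \<zero>\<^bsub>part C p\<^esub>) \<longrightarrow>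
        snd (sprod B xs) = \<zero>\<^bsub>part B (fst (sprod B xs))\<^esub>)"

definition weil_alg :: "('k, 'k, 'y) super_alg_scheme \<Rightarrow> ('k, 'a, 'z) super_alg_scheme \<Rightarrow> bool" where
  "weil_alg K B \<longleftrightarrow> is_super_comm_alg K B \<and> fin_gen_over K B \<and>
     (\<exists>h. is_super_alg_hom K B K h \<and> nilpotent_kernel B K h)"


section \<open>Super Fermat theories\<close>

record 'f super_theory = "'f law_theory" +
  from_SCom :: "scom_arr \<Rightarrow> 'f"

definition const_op ::
  "('f, 'z) super_theory_scheme \<Rightarrow> ('f, 'a) salg \<Rightarrow> bit \<Rightarrow> sterm \<Rightarrow> 'a" where
  "const_op S A p t = app S A (from_SCom S (scom_op zobj p t)) (\<lambda>_ _. undefined)"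

text \<open>
  The operation of parity \<open>r\<close> given by a term \<open>t\<close> in two variables of parities \<open>p\<close> and \<open>q\<close>.  The second
  variable is number 1 if \<open>q = p\<close> and number 0 otherwise.
\<close>

definition second :: "bit \<Rightarrow> bit \<Rightarrow> nat" where
  "second p q = (if q = p then 1 else 0)"

definition bin_op ::
  "('f, 'z) super_theory_scheme \<Rightarrow> ('f, 'a) salg \<Rightarrow> bit \<Rightarrow> bit \<Rightarrow> bit \<Rightarrow> sterm \<Rightarrow> 'a \<Rightarrow> 'a \<Rightarrow> 'a" where
  "bin_op S A p q r t a b =
     app S A (from_SCom S (scom_op (padd (sobj p) (sobj q)) r t))
       (\<lambda>u i. if u = p \<and> i = 0 then a else b)"

text \<open>
  The underlying K-superalgebra, with K the free algebra on no generators.  An element \<open>k\<close> of K is a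
  nullary operation, and \<open>cst\<close> is its value.
\<close>

definition sharp :: "('f, 'z) super_theory_scheme \<Rightarrow> ('f, 'a) salg \<Rightarrow> ('f, 'a) super_alg" where
  "sharp S A = \<lparr>
     part = (\<lambda>p. \<lparr>
       carrier = ob A (sobj p),
       mult = undefined, one = undefined,
       zero = const_op S A p (TZero p),
       add = bin_op S A p p p (TAdd (TVar p 0) (TVar p 1))\<rparr>),
     act = (\<lambda>p q. bin_op S A p q (p + q) (TMul (TVar p 0) (TVar q (second p q)))),
     unt = const_op S A 0 TOne,
     cst = (\<lambda>p k. app S A k (\<lambda>_ _. undefined))\<rparr>"

definition ground :: "('f, 'z) super_theory_scheme \<Rightarrow> ('f, 'f) super_alg" where
  "ground S = sharp S (free_salg S zobj)"

text \<open>
  Both Fermat conditions concern an element \<open>f\<close> of parity \<open>q\<close> of \<open>free_salg S X\<close> and its variable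
  \<open>(p, i)\<close>; the remaining variables of \<open>X\<close> are the parameters.  The object \<open>padd X (sobj p)\<close> has the
  additional variable \<open>(p, X p)\<close>, and the following is f(x, ...) - f(y, ...) where \<open>x\<close> is the variable
  \<open>(p, i)\<close> and \<open>y\<close> is the additional one.
\<close>

definition fdiff ::
  "('f, 'z) super_theory_scheme \<Rightarrow> sdim \<Rightarrow> bit \<Rightarrow> bit \<Rightarrow> nat \<Rightarrow> 'f \<Rightarrow> 'f" where
  "fdiff S X q p i f =
     (let Y = padd X (sobj p); F = free_salg S Y in
        app S F f (\<lambda>r j. prj S Y r j) \<ominus>\<^bsub>part (sharp S F) q\<^esub>
        app S F f (\<lambda>r j. if r = p \<and> j = i then prj S Y p (X p) else prj S Y r j))"

definition vdiff :: "('f, 'z) super_theory_scheme \<Rightarrow> sdim \<Rightarrow> bit \<Rightarrow> nat \<Rightarrow> 'f" where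
  "vdiff S X p i =
     (let Y = padd X (sobj p); F = free_salg S Y in
        prj S Y p i \<ominus>\<^bsub>part (sharp S F) p\<^esub> prj S Y p (X p))"

definition even_quotient ::
  "('f, 'z) super_theory_scheme \<Rightarrow> sdim \<Rightarrow> bit \<Rightarrow> nat \<Rightarrow> 'f \<Rightarrow> 'f \<Rightarrow> bool" where
  "even_quotient S X q i f g \<longleftrightarrow>
     (let Y = padd X (sobj 0) in
        g \<in> Hom S Y (sobj q) \<and>
        fdiff S X q 0 i f = act (sharp S (free_salg S Y)) 0 q (vdiff S X 0 i) g)"

text \<open>
  In the odd condition the quotient \<open>h\<close> depends on the parameters only: its \<open>j\<close>-th odd variable is
  the \<open>j\<close>-th odd variable of \<open>X\<close> other than number \<open>i\<close>.
\<close>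

definition without_odd :: "sdim \<Rightarrow> sdim" where
  "without_odd X = X(1 := X 1 - 1)"

definition skip_odd ::
  "('f, 'z) super_theory_scheme \<Rightarrow> sdim \<Rightarrow> nat \<Rightarrow> bit \<Rightarrow> nat \<Rightarrow> 'f" where
  "skip_odd S X i r j = prj S X r (if r = 1 \<and> i \<le> j then Suc j else j)"

definition odd_quotient ::
  "('f, 'z) super_theory_scheme \<Rightarrow> sdim \<Rightarrow> bit \<Rightarrow> nat \<Rightarrow> 'f \<Rightarrow> 'f \<Rightarrow> bool" where
  "odd_quotient S X q i f h \<longleftrightarrow>
     (let Y = padd X (sobj 1); F = free_salg S Y in
        h \<in> Hom S (without_odd X) (sobj (1 + q)) \<and>
        fdiff S X q 1 i f =
          act (sharp S F) 1 (1 + q) (vdiff S X 1 i) (app S F h (skip_odd S Y i)))"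

definition super_fermat_theory :: "('f, 'z) super_theory_scheme \<Rightarrow> bool" where
  "super_fermat_theory S \<longleftrightarrow>
     lawvere_theory S \<and>
     theory_morphism SCom S (from_SCom S) \<and>
     (\<forall>X q i. \<forall>f\<in>Hom S X (sobj q). i < X 0 \<longrightarrow> (\<exists>!g. even_quotient S X q i f g)) \<and>
     (\<forall>X q i. \<forall>f\<in>Hom S X (sobj q). i < X 1 \<longrightarrow> (\<exists>!h. odd_quotient S X q i f h))"

text \<open>
  The derivative of \<open>f\<close>, of parity \<open>q\<close>, with respect to the variable \<open>(p, i)\<close> of \<open>X\<close>.  It is again an
  element of \<open>free_salg S X\<close>, of parity \<open>p + q\<close>.
\<close>

definition sderiv ::
  "('f, 'z) super_theory_scheme \<Rightarrow> sdim \<Rightarrow> bit \<Rightarrow> bit \<Rightarrow> nat \<Rightarrow> 'f \<Rightarrow> 'f" where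
  "sderiv S X q p i f =
     (if p = 0
      then app S (free_salg S X) (THE g. even_quotient S X q i f g)
             (\<lambda>r j. if r = 0 \<and> j = X 0 then prj S X 0 i else prj S X r j)
      else app S (free_salg S X) (THE h. odd_quotient S X q i f h) (skip_odd S X i))"


section \<open>Near-point determined algebras and derivations\<close>

text \<open>
  A Weil algebra carries exactly one compatible algebra structure, so the Weil algebras are the
  algebras \<open>W\<close> with Weil \<open>sharp S W\<close>.  The type of their elements has to be a parameter; up to
  isomorphism all of them occur when it is large enough (\<open>'w = 'f\<close> suffices).
\<close>

definition near_point_determined ::
  "'w itself \<Rightarrow> ('f, 'z) super_theory_scheme \<Rightarrow> ('f, 'a) salg \<Rightarrow> bool" where
  "near_point_determined _ S A \<longleftrightarrow>
     (\<forall>p. \<forall>a\<in>ob A (sobj p). \<forall>b\<in>ob A (sobj p). a \<noteq> b \<longrightarrow>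
        (\<exists>(W :: ('f, 'w) salg) h. s_algebra S W \<and> weil_alg (ground S) (sharp S W) \<and>
           salg_hom S A W h \<and> h (sobj p) a \<noteq> h (sobj p) b))"

text \<open>
  An element of \<open>(square_zero S A M)(X)\<close> is a pair \<open>(t, u)\<close>, where \<open>t\<close> in \<open>A(X)\<close> is the tuple of the
  a's and b's, and \<open>u p i\<close> in \<open>M\<close> is the coefficient of epsilon in the component \<open>(p, i)\<close>.
\<close>

definition square_zero ::
  "('f, 'z) super_theory_scheme \<Rightarrow> ('f, 'a) salg \<Rightarrow> ('a, 'm) super_module \<Rightarrow>
   ('f, 'a \<times> (bit \<Rightarrow> nat \<Rightarrow> 'm)) salg" where
  "square_zero S A M = \<lparr>
     ob = (\<lambda>X. {(t, u). t \<in> ob A X \<and> (\<forall>p. u p \<in> {..<X p} \<rightarrow>\<^sub>E carrier (part M p))}),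
     mor = (\<lambda>f (t, u).
       (mor A f t,
        \<lambda>q. \<lambda>k\<in>{..<tgt S f q}.
          finsum (part M q)
            (\<lambda>(p, i). ract M p (p + q) (u p i)
               (mor A (sderiv S (src S f) q p i (cmp S (prj S (tgt S f) q k) f)) t))
            (SIGMA p:{0, 1}. {..<src S f p})))\<rparr>"

text \<open>The map sending \<open>a\<close> to \<open>a + epsilon D(a)\<close>, which is a section of the projection \<open>fst\<close>.\<close>

definition eps_section ::
  "('f, 'z) super_theory_scheme \<Rightarrow> ('f, 'a) salg \<Rightarrow> (bit \<Rightarrow> 'a \<Rightarrow> 'm) \<Rightarrow>
   sdim \<Rightarrow> 'a \<Rightarrow> 'a \<times> (bit \<Rightarrow> nat \<Rightarrow> 'm)" where
  "eps_section S A D X t = (t, \<lambda>p. \<lambda>i\<in>{..<X p}. D p (mor A (prj S X p i) t))"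

definition salg_derivation ::
  "('f, 'z) super_theory_scheme \<Rightarrow> ('f, 'a) salg \<Rightarrow> ('a, 'm) super_module \<Rightarrow> (bit \<Rightarrow> 'a \<Rightarrow> 'm) \<Rightarrow> bool" where
  "salg_derivation S A M D \<longleftrightarrow> salg_hom S A (square_zero S A M) (eps_section S A D)"

end

theory Submission
  imports Defs
begin

text \<open>
  Fix elements \<open>a\<close> of \<open>A\<close>, one for each variable, and let \<open>u\<^sub>i = D(a\<^sub>i)\<close>.  The claim is the chain rule
  \<open>D(f(a)) = \<Sum> u\<^sub>i (\<partial>\<^sub>i f)(a)\<close> for every operation \<open>f\<close>.  Let \<open>E(f)\<close> be the difference of the two sides.  It is a
  derivation along the evaluation at \<open>a\<close> on the free algebra, and it vanishes on the constants from \<open>K\<close> and on the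
  variables (\<open>defect_mult\<close>, \<open>defect_cst\<close>, \<open>defect_prj\<close>), hence on polynomials.  To pass from polynomials to
  all \<open>f\<close>, compose \<open>E\<close> with a coordinate function of the free module \<open>M\<close> and with a homomorphism from \<open>A\<close> to a Weil
  algebra \<open>W\<close>; near-point determinacy says that these compositions together detect zero (\<open>defect_zero\<close>).
  If \<open>k\<close> is the \<open>K\<close>-point below the resulting \<open>W\<close>-point, Hadamard's lemma writes \<open>f\<close> as its value at \<open>k\<close>
  plus multiples of the \<open>x\<^sub>i - k\<^sub>i\<close>, whose values in \<open>W\<close> are nilpotent and on which \<open>E\<close> vanishes.  So \<open>E(f)\<close> lies in
  the nilpotent kernel times the values of \<open>E\<close>, and by iteration it is zero in \<open>W\<close> (\<open>defect_killed\<close>).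

  The Leibniz rule for the partial derivatives is a statement about the Fermat quotients.  The odd quotient
  is required not to depend on the variable in question, which the obvious quotient of a product
  violates.  The key is \<open>annihilated_by_vdiff\<close>: a function that is annihilated by \<open>x - y\<close>
  vanishes for \<open>y = x\<close>, in both parities.  By \<open>sderiv_quotient\<close> every quotient then computes the derivative, and the
  rules of differentiation have one proof for even and odd variables.

  All these calculations take place in the superalgebras underlying the \<open>S\<close>-algebras.  Their axioms are
  obtained by interpreting terms, since provably equal terms are the same arrow of the theory of
  superalgebras (\<open>term_op_tsubst\<close>, \<open>sharp_super_comm_ring\<close>).
\<close>

section \<open>Lawvere theories and their algebras\<close>

abbreviation assignment :: "('f, 'a) salg \<Rightarrow> sdim \<Rightarrow> (bit \<Rightarrow> nat \<Rightarrow> 'a) \<Rightarrow> bool" where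
  "assignment A X c \<equiv> \<forall>p i. i < X p \<longrightarrow> c p i \<in> ob A (sobj p)"

lemma sobj_simps [simp]: "sobj p p = 1" "q \<noteq> p \<Longrightarrow> sobj p q = 0"
  by (auto simp: sobj_def)

lemma zobj_apply [simp]: "zobj p = 0"
  by (simp add: zobj_def)

lemma padd_apply [simp]: "padd X Y p = X p + Y p"
  by (simp add: padd_def)

lemma padd_eta [simp]: "(\<lambda>p. X p + Y p) = padd X Y"
  by (simp add: padd_def)

lemma zobj_eta [simp]: "(\<lambda>_. 0) = zobj"
  by (simp add: zobj_def)

lemma less_sobj [simp]: "i < sobj p q \<longleftrightarrow> q = p \<and> i = 0"
  by (auto simp: sobj_def)

lemma Hom_src: "f \<in> Hom T X Y \<Longrightarrow> src T f = X" and Hom_tgt: "f \<in> Hom T X Y \<Longrightarrow> tgt T f = Y"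
  by (auto simp: Hom_def)

lemma free_simps [simp]: "ob (free_salg T X) Y = Hom T X Y" "mor (free_salg T X) = cmp T"
  by (auto simp: free_salg_def)

locale lawvere =
  fixes T :: "('f, 'z) law_theory_scheme"
  assumes lawvere: "lawvere_theory T"
begin

lemma idn_Hom [simp]: "idn T X \<in> Hom T X X"
  using lawvere unfolding lawvere_theory_def by (elim conjE) (erule spec)

lemma cmp_Hom: "f \<in> Hom T X Y \<Longrightarrow> g \<in> Hom T Y Z \<Longrightarrow> cmp T g f \<in> Hom T X Z"
  using lawvere unfolding lawvere_theory_def by (elim conjE) meson

lemma cmp_idn: "f \<in> Hom T X Y \<Longrightarrow> cmp T f (idn T X) = f"
  and idn_cmp: "f \<in> Hom T X Y \<Longrightarrow> cmp T (idn T Y) f = f"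
  using lawvere unfolding lawvere_theory_def by (elim conjE, meson)+

lemma cmp_assoc: "f \<in> Hom T W X \<Longrightarrow> g \<in> Hom T X Y \<Longrightarrow> h \<in> Hom T Y Z \<Longrightarrow>
    cmp T h (cmp T g f) = cmp T (cmp T h g) f"
  using lawvere unfolding lawvere_theory_def by (elim conjE) meson

lemma prj_Hom: "i < X p \<Longrightarrow> prj T X p i \<in> Hom T X (sobj p)"
  using lawvere unfolding lawvere_theory_def by (elim conjE) meson

lemma free_algebra: "s_algebra T (free_salg T X)"
  unfolding s_algebra_def free_simps
proof (intro conjI)
  show "\<forall>Y c. (\<forall>p i. i < Y p \<longrightarrow> c p i \<in> Hom T X (sobj p)) \<longrightarrow>
      (\<exists>!a. a \<in> Hom T X Y \<and> (\<forall>p i. i < Y p \<longrightarrow> cmp T (prj T Y p i) a = c p i))"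
    using lawvere unfolding lawvere_theory_def by (elim conjE) (rule allI, erule allE, erule allE, assumption)
qed (auto intro: cmp_Hom idn_cmp cmp_assoc[symmetric])

lemma algD:
  assumes "s_algebra T A"
  shows mor_ob: "f \<in> Hom T X Y \<Longrightarrow> a \<in> ob A X \<Longrightarrow> mor A f a \<in> ob A Y"
    and mor_cmp: "f \<in> Hom T X Y \<Longrightarrow> g \<in> Hom T Y Z \<Longrightarrow> a \<in> ob A X \<Longrightarrow>
      mor A (cmp T g f) a = mor A g (mor A f a)"
  using assms unfolding s_algebra_def by blast+

lemma
  assumes A: "s_algebra T A" and c: "assignment A X c"
  shows tup_ob: "tup T A X c \<in> ob A X"
    and mor_prj_tup: "i < X p \<Longrightarrow> mor A (prj T X p i) (tup T A X c) = c p i"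
proof -
  have "\<exists>!a. a \<in> ob A X \<and> (\<forall>p i. i < X p \<longrightarrow> mor A (prj T X p i) a = c p i)"
    using A c unfolding s_algebra_def by blast
  from theI'[OF this] show "tup T A X c \<in> ob A X"
    and "i < X p \<Longrightarrow> mor A (prj T X p i) (tup T A X c) = c p i"
    unfolding tup_def by auto
qed

lemma ob_eqI:
  assumes A: "s_algebra T A" and ab: "a \<in> ob A X" "b \<in> ob A X"
    and eq: "\<And>p i. i < X p \<Longrightarrow> mor A (prj T X p i) a = mor A (prj T X p i) b"
  shows "a = b"
proof -
  have "assignment A X (\<lambda>p i. mor A (prj T X p i) b)"
    using mor_ob[OF A prj_Hom ab(2)] by blast
  then have "\<exists>!a. a \<in> ob A X \<and> (\<forall>p i. i < X p \<longrightarrow> mor A (prj T X p i) a = mor A (prj T X p i) b)"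
    using A unfolding s_algebra_def by (elim conjE allE[of _ X]) (erule allE, erule mp)
  then show ?thesis using ab eq by blast
qed

lemma tup_eqI:
  assumes "s_algebra T A" "a \<in> ob A X" "\<And>p i. i < X p \<Longrightarrow> mor A (prj T X p i) a = c p i"
  shows "tup T A X c = a"
proof -
  have c: "assignment A X c" using mor_ob[OF assms(1) prj_Hom assms(2)] assms(3) by metis
  show ?thesis
    by (rule ob_eqI[OF assms(1) tup_ob[OF assms(1) c] assms(2)])
      (simp add: mor_prj_tup[OF assms(1) c] assms(3))
qed

lemma mor_tup:
  assumes A: "s_algebra T A" and c: "assignment (free_salg T Y) X c" and a: "a \<in> ob A Y"
  shows "mor A (tup T (free_salg T Y) X c) a = tup T A X (\<lambda>p i. mor A (c p i) a)"
proof -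
  note t = tup_ob[OF free_algebra c, unfolded free_simps]
  show ?thesis
  proof (rule tup_eqI[symmetric, OF A])
    show "mor A (tup T (free_salg T Y) X c) a \<in> ob A X" by (rule mor_ob[OF A t a])
    fix p i assume i: "i < X p"
    show "mor A (prj T X p i) (mor A (tup T (free_salg T Y) X c) a) = mor A (c p i) a"
      using mor_cmp[OF A t prj_Hom[of i X p, OF i] a] mor_prj_tup[OF free_algebra c i] by simp
  qed
qed

lemma app_mor: "f \<in> Hom T X Y \<Longrightarrow> app T A f c = mor A f (tup T A X c)"
  by (simp add: app_def Hom_src)

lemma tup_cong: "(\<And>p i. i < X p \<Longrightarrow> c p i = d p i) \<Longrightarrow> tup T A X c = tup T A X d"
  unfolding tup_def by (rule arg_cong[of _ _ The]) auto

lemma tup_prj: "tup T (free_salg T X) X (prj T X) = idn T X"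
  by (rule tup_eqI[OF free_algebra]) (auto intro: cmp_idn prj_Hom)

lemma tup_zobj: "c \<in> Hom T X zobj \<Longrightarrow> tup T (free_salg T X) zobj d = c"
  by (rule tup_eqI[OF free_algebra]) auto

lemma hom_tup:
  assumes A: "s_algebra T A" and B: "s_algebra T B" and h: "salg_hom T A B h"
    and c: "assignment A X c"
  shows "h X (tup T A X c) = tup T B X (\<lambda>p i. h (sobj p) (c p i))"
proof (rule tup_eqI[symmetric, OF B])
  note t = tup_ob[OF A c]
  show "h X (tup T A X c) \<in> ob B X" using h t unfolding salg_hom_def by blast
  fix p i assume i: "i < X p"
  show "mor B (prj T X p i) (h X (tup T A X c)) = h (sobj p) (c p i)"
    using h t prj_Hom[of i X p, OF i] mor_prj_tup[OF A c i] unfolding salg_hom_def by metis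
qed

lemma hom_app:
  assumes A: "s_algebra T A" and B: "s_algebra T B" and h: "salg_hom T A B h"
    and f: "f \<in> Hom T X Y" and c: "assignment A X c"
  shows "h Y (app T A f c) = app T B f (\<lambda>p i. h (sobj p) (c p i))"
proof -
  have "h Y (mor A f (tup T A X c)) = mor B f (h X (tup T A X c))"
    using h f tup_ob[OF A c] unfolding salg_hom_def by blast
  then show ?thesis by (simp add: app_mor[OF f] hom_tup[OF A B h c])
qed

text \<open>By functoriality, evaluation at an element \<open>a\<close> of \<open>A(X)\<close> is the homomorphism from the free algebra
  that sends the variables to the components of \<open>a\<close>.\<close>

lemma evaluation_hom:
  assumes A: "s_algebra T A" and a: "a \<in> ob A X"
  shows "salg_hom T (free_salg T X) A (\<lambda>Y f. mor A f a)"
  unfolding salg_hom_def using mor_ob[OF A _ a] mor_cmp[OF A _ _ a] by auto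

end

section \<open>Operations given by superalgebra terms\<close>

lemma bit_add_simps [simp]: "(p::bit) + p = 0" "(p::bit) + (p + q) = q" "(p::bit) + (q + p) = q"
  "(p::bit) + q + p = q" "(p::bit) + q + q = p"
  by (cases p; cases q; simp)+

text \<open>Sums of parities are to be normalised as sums, not to be turned into case distinctions.\<close>

declare add_bit_eq_xor [simp del] mult_bit_eq_and [simp del]

lemma wt_TMul: "wt X p s \<Longrightarrow> wt X q t \<Longrightarrow> r = p + q \<Longrightarrow> wt X r (TMul s t)"
  by (simp add: wt.intros)

lemma teq_wt: "teq X p s t \<Longrightarrow> wt X p s \<and> wt X p t"
proof (induction rule: teq.induct)
  case (mul_assoc p s q t r u)
  then show ?case by (auto intro!: wt_TMul simp: add.assoc)
next
  case (mul_comm p s q t)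
  then show ?case by (auto intro!: wt_TMul simp: add.commute)
next
  case (mul_anticomm s t)
  then show ?case by (auto intro!: wt_TMul wt.intros)
next
  case (mul_one p t)
  then show ?case by (auto intro!: wt_TMul wt.intros)
qed (auto intro: wt.intros)

lemma wt_tsubst: "wt X p t \<Longrightarrow> (\<And>q i. i < X q \<Longrightarrow> wt Y q (\<sigma> q i)) \<Longrightarrow> wt Y p (tsubst \<sigma> t)"
  by (induction rule: wt.induct) (auto intro: wt.intros)

lemma teq_tsubst:
  "teq X p s t \<Longrightarrow> (\<And>q i. i < X q \<Longrightarrow> wt Y q (\<sigma> q i)) \<Longrightarrow> teq Y p (tsubst \<sigma> s) (tsubst \<sigma> t)"
proof (induction rule: teq.induct)
  case (mul_comm p s q t)
  then show ?case using teq.mul_comm[of Y p "tsubst \<sigma> s" q "tsubst \<sigma> t"] by (simp add: wt_tsubst)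
qed (auto intro: teq.intros wt_tsubst wt.intros simp del: bit_add_simps)

lemma tsubst_teq:
  "wt X p t \<Longrightarrow> (\<And>q i. i < X q \<Longrightarrow> teq Y q (\<sigma> q i) (\<tau> q i)) \<Longrightarrow> teq Y p (tsubst \<sigma> t) (tsubst \<tau> t)"
  by (induction rule: wt.induct) (auto intro: teq.intros wt.intros)

lemma tclass_eqI: "teq X p s t \<Longrightarrow> tclass X p s = tclass X p t"
  unfolding tclass_def using teq.sym teq.trans by blast

definition scom_tup :: "sdim \<Rightarrow> sdim \<Rightarrow> (bit \<Rightarrow> nat \<Rightarrow> sterm) \<Rightarrow> scom_arr" where
  "scom_tup X Y ts = (X, \<lambda>q. map (\<lambda>i. tclass X q (ts q i)) [0..<Y q])"

lemma scom_op_Hom: "wt X p t \<Longrightarrow> scom_op X p t \<in> Hom SCom X (sobj p)"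
  by (auto simp: Hom_def SCom_def scom_op_def sobj_def)

lemma scom_tup_Hom: "(\<And>q i. i < Y q \<Longrightarrow> wt X q (ts q i)) \<Longrightarrow> scom_tup X Y ts \<in> Hom SCom X Y"
  by (fastforce simp: Hom_def SCom_def scom_tup_def)

lemma prj_SCom: "prj SCom X p i = scom_op X p (TVar p i)"
  by (simp add: SCom_def scom_op_def)

text \<open>Composition in the theory of superalgebras may be computed on representatives because provable
  equality is stable under substitution in both arguments.\<close>

lemma cmp_SCom:
  assumes t: "wt Y p t" and ts: "\<And>q i. i < Y q \<Longrightarrow> wt X q (ts q i)"
  shows "cmp SCom (scom_op Y p t) (scom_tup X Y ts) = scom_op X p (tsubst ts t)"
proof -
  have "(\<exists>t'. teq Y p t t' \<and> (\<exists>\<sigma>. (\<forall>q i. i < Y q \<longrightarrow> teq X q (ts q i) (\<sigma> q i)) \<and>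
      teq X p (tsubst \<sigma> t') u)) \<longleftrightarrow> teq X p (tsubst ts t) u" (is "?L \<longleftrightarrow> ?R") for u
  proof
    assume ?L
    then obtain t' \<sigma> where t': "teq Y p t t'" and \<sigma>: "\<And>q i. i < Y q \<Longrightarrow> teq X q (ts q i) (\<sigma> q i)"
      and u: "teq X p (tsubst \<sigma> t') u" by blast
    have "teq X p (tsubst ts t) (tsubst ts t')" by (rule teq_tsubst[OF t' ts])
    moreover have "teq X p (tsubst ts t') (tsubst \<sigma> t')"
      using teq_wt[OF t'] \<sigma> by (intro tsubst_teq) auto
    ultimately show ?R using u by (blast intro: teq.trans)
  next
    assume ?R
    then show ?L using t ts by (blast intro: teq.refl)
  qed
  then show ?thesis
    by (auto simp: SCom_def scom_op_def scom_tup_def tclass_def fun_eq_iff)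
qed

text \<open>Every superalgebra expression in elements of an \<open>S\<close>-algebra is the value of one term, which is why the
  identities of superalgebras can be read off from provable equality of terms.\<close>

definition term_op ::
  "('f, 'z) super_theory_scheme \<Rightarrow> ('f, 'a) salg \<Rightarrow> sdim \<Rightarrow> bit \<Rightarrow> sterm \<Rightarrow> (bit \<Rightarrow> nat \<Rightarrow> 'a) \<Rightarrow> 'a" where
  "term_op S A X p t c = app S A (from_SCom S (scom_op X p t)) c"

lemma sharp_carrier [simp]: "carrier (part (sharp S A) p) = ob A (sobj p)"
  by (simp add: sharp_def)

lemma sharp_consts:
  "\<zero>\<^bsub>part (sharp S A) p\<^esub> = term_op S A zobj p (TZero p) (\<lambda>_ _. undefined)"
  "unt (sharp S A) = term_op S A zobj 0 TOne (\<lambda>_ _. undefined)"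
  by (auto simp: sharp_def const_op_def term_op_def)

lemma sharp_add: "a \<oplus>\<^bsub>part (sharp S A) p\<^esub> b = term_op S A (padd (sobj p) (sobj p)) p
    (TAdd (TVar p 0) (TVar p 1)) (\<lambda>u i. if u = p \<and> i = 0 then a else b)"
  by (simp add: sharp_def bin_op_def term_op_def)

lemma sharp_act: "act (sharp S A) p q a b = term_op S A (padd (sobj p) (sobj q)) (p + q)
    (TMul (TVar p 0) (TVar q (second p q))) (\<lambda>u i. if u = p \<and> i = 0 then a else b)"
  by (simp add: sharp_def bin_op_def term_op_def)

locale super_theory = lawvere S for S :: "('f, 'z) super_theory_scheme" +
  assumes from_SCom: "theory_morphism SCom S (from_SCom S)"
begin

lemma from_SCom_Hom: "f \<in> Hom SCom X Y \<Longrightarrow> from_SCom S f \<in> Hom S X Y"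
  and from_SCom_cmp: "f \<in> Hom SCom X Y \<Longrightarrow> g \<in> Hom SCom Y Z \<Longrightarrow>
    from_SCom S (cmp SCom g f) = cmp S (from_SCom S g) (from_SCom S f)"
  and from_SCom_prj: "i < X p \<Longrightarrow> from_SCom S (prj SCom X p i) = prj S X p i"
  using from_SCom unfolding theory_morphism_def by (elim conjE, meson)+

lemma op_Hom: "wt X p t \<Longrightarrow> from_SCom S (scom_op X p t) \<in> Hom S X (sobj p)"
  by (rule from_SCom_Hom[OF scom_op_Hom])

lemma term_op_ob:
  "s_algebra S A \<Longrightarrow> assignment A X c \<Longrightarrow> wt X p t \<Longrightarrow> term_op S A X p t c \<in> ob A (sobj p)"
  unfolding term_op_def by (simp add: app_mor[OF op_Hom] mor_ob[OF _ op_Hom tup_ob])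

lemma term_op_var:
  "s_algebra S A \<Longrightarrow> assignment A X c \<Longrightarrow> i < X p \<Longrightarrow> term_op S A X p (TVar p i) c = c p i"
  unfolding term_op_def prj_SCom[symmetric]
  by (simp add: from_SCom_prj app_mor[OF prj_Hom[of i X p]] mor_prj_tup)

lemma term_op_teq: "teq X p s t \<Longrightarrow> term_op S A X p s c = term_op S A X p t c"
  by (metis tclass_eqI term_op_def scom_op_def)

lemma term_op_cong: "wt X p t \<Longrightarrow> (\<And>q i. i < X q \<Longrightarrow> c q i = d q i) \<Longrightarrow>
    term_op S A X p t c = term_op S A X p t d"
  by (simp add: term_op_def app_mor[OF op_Hom] tup_cong[of X c d])

text \<open>The morphism from the theory of superalgebras preserves composition, and composition of term classes is
  substitution.  The instances for single symbols below say that the value of a term is computed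
  recursively with the operations of the underlying superalgebra.\<close>

lemma term_op_tsubst:
  assumes A: "s_algebra S A" and c: "assignment A X c"
    and t: "wt Y p t" and ts: "\<And>q i. i < Y q \<Longrightarrow> wt X q (ts q i)"
  shows "term_op S A X p (tsubst ts t) c = term_op S A Y p t (\<lambda>q i. term_op S A X q (ts q i) c)"
proof -
  let ?a = "tup S A X c" and ?b = "mor A (from_SCom S (scom_tup X Y ts)) (tup S A X c)"
  note a = tup_ob[OF A c]
  have ts_Hom: "scom_tup X Y ts \<in> Hom SCom X Y" by (rule scom_tup_Hom[OF ts])
  have cmp: "mor A (from_SCom S (scom_op Y q u)) ?b = term_op S A X q (tsubst ts u) c"
    if u: "wt Y q u" for q u
  proof -
    have "mor A (from_SCom S (scom_op Y q u)) ?b =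
        mor A (from_SCom S (cmp SCom (scom_op Y q u) (scom_tup X Y ts))) ?a"
      using mor_cmp[OF A from_SCom_Hom[OF ts_Hom] op_Hom[OF u] a]
        from_SCom_cmp[OF ts_Hom scom_op_Hom[OF u]] by simp
    also have "\<dots> = term_op S A X q (tsubst ts u) c"
      by (simp add: cmp_SCom[OF u ts] term_op_def app_mor[OF op_Hom[OF wt_tsubst[OF u ts]]])
    finally show ?thesis .
  qed
  have "tup S A Y (\<lambda>q i. term_op S A X q (ts q i) c) = ?b"
  proof (rule tup_eqI[OF A mor_ob[OF A from_SCom_Hom[OF ts_Hom] a]])
    fix q i assume i: "i < Y q"
    show "mor A (prj S Y q i) ?b = term_op S A X q (ts q i) c"
      using cmp[OF wt.intros(1)[of i Y q, OF i]] i by (simp add: from_SCom_prj flip: prj_SCom)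
  qed
  then show ?thesis by (simp add: term_op_def[of S A Y] app_mor[OF op_Hom[OF t]] cmp[OF t])
qed

lemma term_op_zero: "s_algebra S A \<Longrightarrow> assignment A X c \<Longrightarrow>
    term_op S A X p (TZero p) c = \<zero>\<^bsub>part (sharp S A) p\<^esub>"
  using term_op_tsubst[of A X c zobj p "TZero p" undefined] term_op_cong[of zobj p "TZero p"]
  by (simp add: wt.intros sharp_consts)

lemma term_op_one: "s_algebra S A \<Longrightarrow> assignment A X c \<Longrightarrow>
    term_op S A X 0 TOne c = unt (sharp S A)"
  using term_op_tsubst[of A X c zobj 0 "TOne" undefined] term_op_cong[of zobj 0 "TOne"]
  by (simp add: wt.intros sharp_consts)

lemma term_op_add:
  assumes A: "s_algebra S A" and c: "assignment A X c" and wt: "wt X p s" "wt X p t"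
  shows "term_op S A X p (TAdd s t) c = term_op S A X p s c \<oplus>\<^bsub>part (sharp S A) p\<^esub> term_op S A X p t c"
  using term_op_tsubst[OF A c, of "padd (sobj p) (sobj p)" p "TAdd (TVar p 0) (TVar p 1)"
      "\<lambda>u i. if u = p \<and> i = 0 then s else t"] wt
  by (force simp: sharp_add wt.intros if_distrib[of "\<lambda>t. term_op S A X _ t c"] sobj_def
      intro!: term_op_cong wt.intros split: if_splits)

lemma term_op_mul:
  assumes A: "s_algebra S A" and c: "assignment A X c" and wt: "wt X p s" "wt X q t"
  shows "term_op S A X (p + q) (TMul s t) c =
    act (sharp S A) p q (term_op S A X p s c) (term_op S A X q t c)"
proof -
  let ?Y = "padd (sobj p) (sobj q)" and ?t = "TMul (TVar p 0) (TVar q (second p q))"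
    and ?ts = "\<lambda>u i. if u = p \<and> i = 0 then s else t"
  have t: "wt ?Y (p + q) ?t" by (intro wt.intros) (auto simp: second_def)
  have ts: "wt X u (?ts u i)" if "i < ?Y u" for u i using that wt by (auto simp: sobj_def split: if_splits)
  have "term_op S A X (p + q) (tsubst ?ts ?t) c = term_op S A ?Y (p + q) ?t (\<lambda>u i. term_op S A X u (?ts u i) c)"
    by (rule term_op_tsubst[OF A c t ts])
  also have "\<dots> = term_op S A ?Y (p + q) ?t
      (\<lambda>u i. if u = p \<and> i = 0 then term_op S A X p s c else term_op S A X q t c)"
    by (rule term_op_cong[OF t]) (auto simp: sobj_def split: if_splits)
  also have "tsubst ?ts ?t = TMul s t" by (auto simp: second_def)
  finally show ?thesis unfolding sharp_act .
qed

end

section \<open>Calculations in supermodules\<close>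

lemma (in abelian_group) minus_self [simp]: "a \<in> carrier G \<Longrightarrow> a \<ominus> a = \<zero>"
  by (simp add: a_minus_def r_neg)

lemma (in abelian_group) zero_minus: "a \<in> carrier G \<Longrightarrow> \<zero> \<ominus> a = \<ominus> a"
  by (simp add: a_minus_def)

lemma (in abelian_group) minus_add_cancel: "a \<in> carrier G \<Longrightarrow> b \<in> carrier G \<Longrightarrow> a \<ominus> b \<oplus> b = a"
  by (simp add: a_minus_def a_assoc l_neg)

lemma (in abelian_group) minus_eq_zero: "a \<in> carrier G \<Longrightarrow> b \<in> carrier G \<Longrightarrow> a \<ominus> b = \<zero> \<Longrightarrow> a = b"
  using minus_add_cancel[of a b] by simp

lemma (in abelian_group) inv_minus: "a \<in> carrier G \<Longrightarrow> b \<in> carrier G \<Longrightarrow> \<ominus> (a \<ominus> b) = b \<ominus> a"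
  by (simp add: a_minus_def minus_add minus_minus a_comm)

lemma (in abelian_group) minus_trans:
  assumes "a \<in> carrier G" "b \<in> carrier G" "c \<in> carrier G"
  shows "(a \<ominus> b) \<oplus> (b \<ominus> c) = a \<ominus> c"
proof -
  have "(a \<ominus> b) \<oplus> (b \<ominus> c) = (a \<ominus> b \<oplus> b) \<ominus> c" using assms by (simp add: a_minus_def a_assoc)
  then show ?thesis using assms by (simp add: minus_add_cancel)
qed

lemma (in abelian_group) minus_minus_minus:
  assumes "a \<in> carrier G" "b \<in> carrier G" "c \<in> carrier G"
  shows "(a \<ominus> b) \<ominus> (a \<ominus> c) = c \<ominus> b"
proof -
  have "(a \<ominus> b) \<ominus> (a \<ominus> c) = (a \<ominus> b) \<oplus> (c \<ominus> a)"
    using assms by (simp add: a_minus_def[of G "a \<ominus> b"] inv_minus)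
  also have "\<dots> = (c \<ominus> a) \<oplus> (a \<ominus> b)" using assms by (simp add: a_comm)
  finally show ?thesis using assms by (simp add: minus_trans)
qed

lemma (in abelian_group) add_minus_add:
  assumes "a \<in> carrier G" "b \<in> carrier G" "c \<in> carrier G" "d \<in> carrier G"
  shows "(a \<oplus> b) \<ominus> (c \<oplus> d) = (a \<ominus> c) \<oplus> (b \<ominus> d)"
  using assms by (simp add: a_minus_def minus_add a_ac)

locale plain_abelian_group = abelian_group G for G :: "'m ring" (structure)

lemma (in plain_abelian_group) ksign_closed [simp]: "x \<in> carrier G \<Longrightarrow> ksign G r x \<in> carrier G"
  by (simp add: ksign_def)

lemma ksign_even [simp]: "ksign G 0 x = x"
  by (simp add: ksign_def)

lemma (in plain_abelian_group) ksign_zero [simp]: "ksign G r \<zero> = \<zero>"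
  by (simp add: ksign_def)

lemma (in plain_abelian_group) ksign_ksign [simp]: "x \<in> carrier G \<Longrightarrow> ksign G r (ksign G s x) = ksign G (r + s) x"
  by (cases r; cases s) (simp_all add: ksign_def minus_minus)

lemma (in plain_abelian_group) ksign_add:
  "x \<in> carrier G \<Longrightarrow> y \<in> carrier G \<Longrightarrow> ksign G r (x \<oplus> y) = ksign G r x \<oplus> ksign G r y"
  by (simp add: ksign_def minus_add a_comm)

lemma (in plain_abelian_group) ksign_finsum:
  assumes "f \<in> I \<rightarrow> carrier G"
  shows "ksign G r (finsum G f I) = finsum G (\<lambda>i. ksign G r (f i)) I"
  using assms
proof (induction I rule: infinite_finite_induct)
  case (insert x I)
  then have f: "f \<in> I \<rightarrow> carrier G" "f x \<in> carrier G" by auto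
  then have "(\<lambda>i. ksign G r (f i)) \<in> I \<rightarrow> carrier G" "ksign G r (f x) \<in> carrier G"
    using insert.prems by (auto intro!: ksign_closed)
  then show ?case using insert f by (simp add: finsum_insert ksign_add finsum_closed)
qed (auto simp: finsum_infinite)

lemma (in plain_abelian_group) ksign_minus:
  "x \<in> carrier G \<Longrightarrow> y \<in> carrier G \<Longrightarrow> ksign G r (x \<ominus> y) = ksign G r x \<ominus> ksign G r y"
  by (simp add: ksign_def a_minus_def minus_add a_comm)

text \<open>Multiplication by an element, substitution, evaluation, derivations and the maps into Weil algebras all
  respect differences, signs and finite sums for the same reason, which is recorded here once.\<close>

definition additive_on :: "'a ring \<Rightarrow> 'b ring \<Rightarrow> ('a \<Rightarrow> 'b) \<Rightarrow> bool" where
  "additive_on G H f \<longleftrightarrow> f \<in> carrier G \<rightarrow> carrier H \<and>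
     (\<forall>x\<in>carrier G. \<forall>y\<in>carrier G. f (x \<oplus>\<^bsub>G\<^esub> y) = f x \<oplus>\<^bsub>H\<^esub> f y)"

lemma additive_on_simps:
  assumes G: "abelian_group G" and H: "abelian_group H" and f: "additive_on G H f"
  shows additive_on_closed: "x \<in> carrier G \<Longrightarrow> f x \<in> carrier H"
    and additive_on_add: "x \<in> carrier G \<Longrightarrow> y \<in> carrier G \<Longrightarrow> f (x \<oplus>\<^bsub>G\<^esub> y) = f x \<oplus>\<^bsub>H\<^esub> f y"
    and additive_on_zero: "f \<zero>\<^bsub>G\<^esub> = \<zero>\<^bsub>H\<^esub>"
    and additive_on_inv: "x \<in> carrier G \<Longrightarrow> f (\<ominus>\<^bsub>G\<^esub> x) = \<ominus>\<^bsub>H\<^esub> f x"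
    and additive_on_minus: "x \<in> carrier G \<Longrightarrow> y \<in> carrier G \<Longrightarrow> f (x \<ominus>\<^bsub>G\<^esub> y) = f x \<ominus>\<^bsub>H\<^esub> f y"
    and additive_on_ksign: "x \<in> carrier G \<Longrightarrow> f (ksign G r x) = ksign H r (f x)"
    and additive_on_finsum: "g \<in> I \<rightarrow> carrier G \<Longrightarrow> f (finsum G g I) = finsum H (\<lambda>i. f (g i)) I"
proof -
  interpret G: abelian_group G by fact
  interpret H: abelian_group H by fact
  show closed: "f x \<in> carrier H" if "x \<in> carrier G" for x
    using f that by (auto simp: additive_on_def)
  show add: "f (x \<oplus>\<^bsub>G\<^esub> y) = f x \<oplus>\<^bsub>H\<^esub> f y" if "x \<in> carrier G" "y \<in> carrier G" for x y
    using f that by (auto simp: additive_on_def)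
  show zero: "f \<zero>\<^bsub>G\<^esub> = \<zero>\<^bsub>H\<^esub>"
    using add[of "\<zero>\<^bsub>G\<^esub>" "\<zero>\<^bsub>G\<^esub>"] closed[of "\<zero>\<^bsub>G\<^esub>"] by simp
  show inv: "f (\<ominus>\<^bsub>G\<^esub> x) = \<ominus>\<^bsub>H\<^esub> f x" if x: "x \<in> carrier G" for x
    using add[of "\<ominus>\<^bsub>G\<^esub> x" x] closed x zero
    by (intro H.minus_equality[symmetric]) (auto simp: G.l_neg)
  show "f (x \<ominus>\<^bsub>G\<^esub> y) = f x \<ominus>\<^bsub>H\<^esub> f y" if "x \<in> carrier G" "y \<in> carrier G"
    using that by (simp add: a_minus_def add inv)
  show "f (ksign G r x) = ksign H r (f x)" if "x \<in> carrier G"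
    using that by (simp add: ksign_def inv)
  show "f (finsum G g I) = finsum H (\<lambda>i. f (g i)) I" if "g \<in> I \<rightarrow> carrier G"
    using that
  proof (induction I rule: infinite_finite_induct)
    case (insert x I)
    then have g: "g \<in> I \<rightarrow> carrier G" "g x \<in> carrier G" by auto
    then have "(\<lambda>i. f (g i)) \<in> I \<rightarrow> carrier H" "f (g x) \<in> carrier H" by (auto intro: closed)
    then show ?case using insert g by (simp add: add)
  qed (auto simp: zero)
qed

locale super_module =
  fixes B :: "('a, 'y) super_ring_scheme" and M :: "('a, 'm, 'z) super_module_scheme"
  assumes comm_ring: "is_super_comm_ring B" and module: "is_super_module B M"
begin

lemma grp [simp, intro]: "abelian_group (part M p)"
  using module unfolding is_super_module_def by (elim conjE) (erule spec)

lemma ring_grp [simp, intro]: "abelian_group (part B p)"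
  using comm_ring unfolding is_super_comm_ring_def is_super_module_def by (elim conjE) (erule spec)

sublocale grp: plain_abelian_group "part M p" for p by (intro plain_abelian_group.intro grp)

lemma act_closed [simp]:
  "r = p + q \<Longrightarrow> a \<in> carrier (part B p) \<Longrightarrow> m \<in> carrier (part M q) \<Longrightarrow> act M p q a m \<in> carrier (part M r)"
  using module unfolding is_super_module_def by (elim conjE) (hypsubst?, meson)

lemma mult_closed [simp]:
  "r = p + q \<Longrightarrow> a \<in> carrier (part B p) \<Longrightarrow> b \<in> carrier (part B q) \<Longrightarrow> act B p q a b \<in> carrier (part B r)"
  using comm_ring unfolding is_super_comm_ring_def is_super_module_def by (elim conjE) (hypsubst?, meson)

lemma unt_closed [simp]: "unt B \<in> carrier (part B 0)"
  using comm_ring unfolding is_super_comm_ring_def by (elim conjE) (hypsubst?, meson)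

lemma act_additive: "r = p + q \<Longrightarrow> a \<in> carrier (part B p) \<Longrightarrow>
    additive_on (part M q) (part M r) (act M p q a)"
  using module unfolding is_super_module_def additive_on_def by (elim conjE) (hypsubst, blast)

lemma act_additive_left: "r = p + q \<Longrightarrow> m \<in> carrier (part M q) \<Longrightarrow>
    additive_on (part B p) (part M r) (\<lambda>a. act M p q a m)"
  using module unfolding is_super_module_def additive_on_def by (elim conjE) (hypsubst, blast)

lemmas act_add = additive_on_add[OF grp grp act_additive]
lemmas act_zero [simp] = additive_on_zero[OF grp grp act_additive]
lemmas act_minus = additive_on_minus[OF grp grp act_additive]
lemmas act_inv = additive_on_inv[OF grp grp act_additive]
lemmas act_ksign = additive_on_ksign[OF grp grp act_additive]
lemmas act_finsum = additive_on_finsum[OF grp grp act_additive]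
lemmas add_act = additive_on_add[OF ring_grp grp act_additive_left]
lemmas zero_act [simp] = additive_on_zero[OF ring_grp grp act_additive_left]
lemmas inv_act = additive_on_inv[OF ring_grp grp act_additive_left]
lemmas minus_act = additive_on_minus[OF ring_grp grp act_additive_left]
lemmas ksign_act = additive_on_ksign[OF ring_grp grp act_additive_left]

lemma act_act: "s = p + q \<Longrightarrow> a \<in> carrier (part B p) \<Longrightarrow> b \<in> carrier (part B q) \<Longrightarrow> m \<in> carrier (part M r) \<Longrightarrow>
    act M s r (act B p q a b) m = act M p (q + r) a (act M q r b m)"
  using module unfolding is_super_module_def by (elim conjE) (hypsubst?, meson)

lemma act_unt [simp]: "m \<in> carrier (part M q) \<Longrightarrow> act M 0 q (unt B) m = m"
  using module unfolding is_super_module_def by (elim conjE) (hypsubst?, meson)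

lemma mult_comm: "r = p + q \<Longrightarrow> a \<in> carrier (part B p) \<Longrightarrow> b \<in> carrier (part B q) \<Longrightarrow>
    act B p q a b = ksign (part B r) (p * q) (act B q p b a)"
  using comm_ring unfolding is_super_comm_ring_def by (elim conjE) (hypsubst?, meson)

lemma act_left_commute:
  assumes "a \<in> carrier (part B p)" "b \<in> carrier (part B q)" "m \<in> carrier (part M r)"
    and "s = q + r" "t = p + r" "u = p + q + r"
  shows "act M p s a (act M q r b m) = ksign (part M u) (p * q) (act M q t b (act M p r a m))"
proof -
  have "act M p s a (act M q r b m) = act M (p + q) r (act B p q a b) m"
    using assms by (simp add: act_act)
  also have "act B p q a b = ksign (part B (p + q)) (p * q) (act B q p b a)"
    using assms by (intro mult_comm) auto
  also have "act M (p + q) r (ksign (part B (p + q)) (p * q) (act B q p b a)) m =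
      ksign (part M u) (p * q) (act M (q + p) r (act B q p b a) m)"
    using assms ksign_act[of u "p + q" r m "act B q p b a" "p * q"] by (simp add: add.commute)
  also have "act M (q + p) r (act B q p b a) m = act M q t b (act M p r a m)"
    using assms by (simp add: act_act)
  finally show ?thesis .
qed

lemma ract_closed [simp]:
  "r = p + q \<Longrightarrow> a \<in> carrier (part B q) \<Longrightarrow> m \<in> carrier (part M p) \<Longrightarrow> ract M p q m a \<in> carrier (part M r)"
  unfolding ract_def by (simp add: add.commute)

lemma ract_additive: assumes "r = p + q" "m \<in> carrier (part M p)"
  shows "additive_on (part B q) (part M r) (ract M p q m)"
  unfolding additive_on_def ract_def
  using assms add_act[of "p + q" q p m] by (auto simp: grp.ksign_add add.commute)

lemmas ract_add = additive_on_add[OF ring_grp grp ract_additive]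
lemmas ract_zero [simp] = additive_on_zero[OF ring_grp grp ract_additive]

text \<open>The partial derivatives of a product \<open>b g\<close> contribute two products to the chain rule.  In each of them the
  signs combine so that one factor can be pulled out as a left multiplication.\<close>

lemma ract_mult_right:
  assumes u: "u \<in> carrier (part M p)" and b: "b \<in> carrier (part B r)" and g: "g \<in> carrier (part B (p + q))"
  shows "ract M p (p + (r + q)) u (ksign (part B (p + (r + q))) (p * r) (act B r (p + q) b g)) =
    act M r q b (ract M p (p + q) u g)"
proof -
  have *: "act M (p + (r + q)) p (act B r (p + q) b g) u = act M r q b (act M (p + q) p g u)"
    using act_act[of "p + (r + q)" r "p + q" b g u p] assms by (simp add: add.commute add.left_commute)
  have "ract M p (p + (r + q)) u (ksign (part B (p + (r + q))) (p * r) (act B r (p + q) b g)) =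
    ksign (part M (r + q)) (p * (p + (r + q)) + p * r) (act M r q b (act M (p + q) p g u))"
    using ksign_act[of "r + q" "p + (r + q)" p u "act B r (p + q) b g" "p * r"] * assms
    by (simp add: ract_def add.commute add.left_commute)
  also have "p * (p + (r + q)) + p * r = p * (p + q)"
    by (cases p; cases r; cases q) simp_all
  also have "ksign (part M (r + q)) (p * (p + q)) (act M r q b (act M (p + q) p g u)) =
      act M r q b (ract M p (p + q) u g)"
    using act_ksign[of "r + q" r q b "act M (p + q) p g u" "p * (p + q)"] assms
    by (simp add: ract_def add.commute)
  finally show ?thesis .
qed

lemma ract_mult_left:
  assumes u: "u \<in> carrier (part M p)" and b: "b \<in> carrier (part B (p + r))" and g: "g \<in> carrier (part B q)"
  shows "ract M p (p + (r + q)) u (act B (p + r) q b g) =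
    ksign (part M (r + q)) (r * q) (act M q r g (ract M p (p + r) u b))"
proof -
  have "ract M p (p + (r + q)) u (act B (p + r) q b g) =
      ksign (part M (r + q)) (p * (p + (r + q))) (act M (p + r) (p + q) b (act M q p g u))"
    using act_act[of "p + (r + q)" "p + r" q b g u p] assms
    by (simp add: ract_def add.commute add.left_commute)
  also have "act M (p + r) (p + q) b (act M q p g u) =
      ksign (part M (r + q)) ((p + r) * q) (act M q r g (act M (p + r) p b u))"
    using assms by (intro act_left_commute) (auto simp: add.commute add.left_commute)
  also have "ksign (part M (r + q)) (p * (p + (r + q))) \<dots> =
      ksign (part M (r + q)) (r * q + p * (p + r)) (act M q r g (act M (p + r) p b u))"
    using assms by (cases p; cases r; cases q) simp_all
  also have "\<dots> = ksign (part M (r + q)) (r * q) (act M q r g (ract M p (p + r) u b))"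
    using assms act_ksign[of "r + q" q r g "act M (p + r) p b u" "p * (p + r)"]
    by (simp add: ract_def add.commute)
  finally show ?thesis .
qed

end

lemma super_module_self: "is_super_comm_ring B \<Longrightarrow> super_module B B"
  unfolding super_module_def is_super_comm_ring_def by blast

lemma (in super_module) mult_unt: "a \<in> carrier (part B p) \<Longrightarrow> act B p 0 a (unt B) = a"
  using mult_comm[of p p 0 a "unt B"] super_module.act_unt[OF super_module_self[OF comm_ring], of a p]
  by simp

section \<open>The underlying superalgebra\<close>

text \<open>This uses that \<open>2\<close> is invertible: supercommutativity only gives \<open>s\<^sup>2 = - s\<^sup>2\<close> for odd \<open>s\<close>.\<close>

lemma teq_odd_square:
  assumes s: "wt X 1 s"
  shows "teq X 0 (TMul s s) (TZero 0)"
proof -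
  let ?P = "TMul s s" and ?h = "TScal (1/2)" and ?z = "TZero 0"
  note tr [trans] = teq.trans
  have P: "wt X 0 ?P" and z: "wt X 0 ?z" using s by (auto intro: wt_TMul wt.intros)
  have half: "teq X 0 t (?h (TAdd t t))" if t: "wt X 0 t" for t
  proof -
    have "teq X 0 t (TScal (1/2 + 1/2) t)" using teq.sym[OF teq.scal_one[OF t]] by simp
    also have "teq X 0 \<dots> (TAdd (?h t) (?h t))" by (rule teq.add_scal[OF t])
    also have "teq X 0 \<dots> (?h (TAdd t t))" by (rule teq.sym[OF teq.scal_add[OF t t]])
    finally show ?thesis .
  qed
  have "teq X 0 ?P (?h (TAdd ?P ?P))" by (rule half[OF P])
  also have "teq X 0 \<dots> (?h (TAdd (TNeg ?P) ?P))"
    by (intro teq.scal_cong teq.add_cong teq.mul_anticomm s teq.refl P)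
  also have "teq X 0 \<dots> (?h ?z)" by (intro teq.scal_cong teq.add_neg P)
  also have "teq X 0 \<dots> (?h (TAdd ?z ?z))" by (intro teq.scal_cong teq.sym[OF teq.add_zero] z)
  also have "teq X 0 \<dots> ?z" by (rule teq.sym[OF half[OF z]])
  finally show ?thesis .
qed

context super_theory
begin

text \<open>Finitely many elements of an algebra are the values of distinct variables, so an identity between
  terms becomes an identity between elements.\<close>

lemma three_variables:
  assumes A: "s_algebra S A" and abc: "a \<in> ob A (sobj p)" "b \<in> ob A (sobj q)" "c \<in> ob A (sobj r)"
  obtains X v where "assignment A X v"
    "wt X p (TVar p 0)" "wt X q (TVar q (Suc 0))" "wt X r (TVar r 2)"
    "term_op S A X p (TVar p 0) v = a" "term_op S A X q (TVar q (Suc 0)) v = b" "term_op S A X r (TVar r 2) v = c"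
proof
  let ?X = "\<lambda>_::bit. 3::nat"
  \<comment> \<open>the other variables need a value of the right parity, for which zero serves\<close>
  let ?v = "\<lambda>u i. if u = p \<and> i = 0 then a else if u = q \<and> i = 1 then b else if u = r \<and> i = 2 then c
    else term_op S A zobj u (TZero u) (\<lambda>_ _. undefined)"
  show v: "assignment A ?X ?v"
    using abc term_op_ob[OF A, of zobj] by (auto intro: wt.intros)
  show "wt ?X p (TVar p 0)" "wt ?X q (TVar q (Suc 0))" "wt ?X r (TVar r 2)" by (auto intro: wt.intros)
  show "term_op S A ?X p (TVar p 0) ?v = a" "term_op S A ?X q (TVar q (Suc 0)) ?v = b"
    "term_op S A ?X r (TVar r 2) ?v = c"
    by (simp_all add: term_op_var[OF A v])
qed

lemma sharp_abelian_group:
  assumes A: "s_algebra S A"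
  shows "abelian_group (part (sharp S A) p)"
proof (rule abelian_groupI; unfold sharp_carrier)
  note ts = term_op_add[OF A] term_op_zero[OF A] wt.intros(2-6)
  show "\<zero>\<^bsub>part (sharp S A) p\<^esub> \<in> ob A (sobj p)"
    unfolding sharp_consts by (rule term_op_ob[OF A]) (auto intro: wt.intros)
  fix a b assume ab: "a \<in> ob A (sobj p)" "b \<in> ob A (sobj p)"
  obtain X v where v: "assignment A X v" "wt X p (TVar p 0)" "wt X p (TVar p (Suc 0))" "wt X p (TVar p 2)"
    and abv: "term_op S A X p (TVar p 0) v = a" "term_op S A X p (TVar p (Suc 0)) v = b"
    using three_variables[OF A ab ab(1)] by metis
  show "a \<oplus>\<^bsub>part (sharp S A) p\<^esub> b \<in> ob A (sobj p)"
    using term_op_ob[OF A v(1), of p "TAdd (TVar p 0) (TVar p (Suc 0))"] v abv by (simp add: ts)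
  show "a \<oplus>\<^bsub>part (sharp S A) p\<^esub> b = b \<oplus>\<^bsub>part (sharp S A) p\<^esub> a"
    using term_op_teq[OF teq.add_comm[OF v(2,3)], of A v] v abv by (simp add: ts)
  show "\<zero>\<^bsub>part (sharp S A) p\<^esub> \<oplus>\<^bsub>part (sharp S A) p\<^esub> a = a"
    using term_op_teq[OF teq.add_zero[OF v(2)], of A v] v abv by (simp add: ts)
  show "\<exists>y\<in>ob A (sobj p). y \<oplus>\<^bsub>part (sharp S A) p\<^esub> a = \<zero>\<^bsub>part (sharp S A) p\<^esub>"
    using term_op_teq[OF teq.add_neg[OF v(2)], of A v] v abv
      term_op_ob[OF A v(1), of p "TNeg (TVar p 0)"] by (auto simp: ts)
next
  note ts = term_op_add[OF A] wt.intros(2-6)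
  fix a b c assume abc: "a \<in> ob A (sobj p)" "b \<in> ob A (sobj p)" "c \<in> ob A (sobj p)"
  obtain X v where v: "assignment A X v" "wt X p (TVar p 0)" "wt X p (TVar p (Suc 0))" "wt X p (TVar p 2)"
    and "term_op S A X p (TVar p 0) v = a" "term_op S A X p (TVar p (Suc 0)) v = b"
     "term_op S A X p (TVar p 2) v = c"
    by (rule three_variables[OF A abc])
  then show "a \<oplus>\<^bsub>part (sharp S A) p\<^esub> b \<oplus>\<^bsub>part (sharp S A) p\<^esub> c =
      a \<oplus>\<^bsub>part (sharp S A) p\<^esub> (b \<oplus>\<^bsub>part (sharp S A) p\<^esub> c)"
    using term_op_teq[OF teq.add_assoc[OF v(2-4)], of A v] by (simp add: ts)
qed

lemma term_op_neg:
  assumes A: "s_algebra S A" and v: "assignment A X v" and t: "wt X p t"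
  shows "term_op S A X p (TNeg t) v = \<ominus>\<^bsub>part (sharp S A) p\<^esub> term_op S A X p t v"
proof -
  interpret abelian_group "part (sharp S A) p" by (rule sharp_abelian_group[OF A])
  have n: "wt X p (TNeg t)" using t by (rule wt.intros)
  show ?thesis
    using term_op_teq[OF teq.add_neg[OF t], of A v] term_op_ob[OF A v] t n
    by (intro minus_equality[symmetric]) (simp_all add: term_op_add[OF A v] term_op_zero[OF A v])
qed

lemma sharp_act_closed:
  assumes A: "s_algebra S A" and ab: "a \<in> ob A (sobj p)" "b \<in> ob A (sobj q)"
  shows "act (sharp S A) p q a b \<in> ob A (sobj (p + q))"
proof -
  obtain X v where v: "assignment A X v" and x: "wt X p (TVar p 0)" "wt X q (TVar q (Suc 0))"
    and abv: "term_op S A X p (TVar p 0) v = a" "term_op S A X q (TVar q (Suc 0)) v = b"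
    using three_variables[OF A ab ab(1)] by metis
  then show ?thesis
    using term_op_ob[OF A v wt_TMul[OF x HOL.refl]] by (simp add: term_op_mul[OF A v x])
qed

lemma sharp_act_comm:
  assumes A: "s_algebra S A" and ab: "a \<in> ob A (sobj p)" "b \<in> ob A (sobj q)"
  shows "act (sharp S A) p q a b = ksign (part (sharp S A) (p + q)) (p * q) (act (sharp S A) q p b a)"
proof -
  obtain X v where v: "assignment A X v" and x: "wt X p (TVar p 0)" "wt X q (TVar q (Suc 0))"
    and abv: "term_op S A X p (TVar p 0) v = a" "term_op S A X q (TVar q (Suc 0)) v = b"
    using three_variables[OF A ab ab(1)] by metis
  have "term_op S A X (p + q) (TMul (TVar q (Suc 0)) (TVar p 0)) v = act (sharp S A) q p b a"
    using term_op_mul[OF A v x(2,1)] abv by (simp add: add.commute)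
  then show ?thesis
    using term_op_teq[OF teq.mul_comm[OF x], of A v] term_op_teq[OF teq.mul_anticomm, of X "TVar p 0" "TVar q (Suc 0)" A v]
      wt_TMul[OF x(2,1)] v x abv term_op_mul[OF A v x]
    by (cases p; cases q) (simp_all add: ksign_def term_op_neg[OF A v])
qed

lemma sharp_act_add:
  assumes A: "s_algebra S A" and abc: "a \<in> ob A (sobj p)" "b \<in> ob A (sobj q)" "c \<in> ob A (sobj q)"
  shows "act (sharp S A) p q a (b \<oplus>\<^bsub>part (sharp S A) q\<^esub> c) =
    act (sharp S A) p q a b \<oplus>\<^bsub>part (sharp S A) (p + q)\<^esub> act (sharp S A) p q a c"
proof -
  obtain X v where v: "assignment A X v"
    and x: "wt X p (TVar p 0)" "wt X q (TVar q (Suc 0))" "wt X q (TVar q 2)"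
    and abv: "term_op S A X p (TVar p 0) v = a" "term_op S A X q (TVar q (Suc 0)) v = b"
      "term_op S A X q (TVar q 2) v = c"
    by (rule three_variables[OF A abc])
  show ?thesis
    using term_op_teq[OF teq.mul_add[OF x], of A v] v x abv wt_TMul[OF x(1,2)] wt_TMul[OF x(1,3)]
    by (simp add: term_op_add[OF A] term_op_mul[OF A] wt.intros(5))
qed

lemma sharp_super_comm_ring:
  assumes A: "s_algebra S A"
  shows "is_super_comm_ring (sharp S A)"
  unfolding is_super_comm_ring_def is_super_module_def sharp_carrier
proof (intro conjI allI ballI)
  fix p show "abelian_group (part (sharp S A) p)" by (rule sharp_abelian_group[OF A])
next
  show "unt (sharp S A) \<in> ob A (sobj 0)"
    unfolding sharp_consts by (rule term_op_ob[OF A]) (auto intro: wt.intros)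
next
  fix p q a b c
  assume abc: "a \<in> ob A (sobj p)" "b \<in> ob A (sobj p)" "c \<in> ob A (sobj q)"
  interpret P: abelian_group "part (sharp S A) p" by (rule sharp_abelian_group[OF A])
  interpret Q: plain_abelian_group "part (sharp S A) (p + q)"
    by (intro plain_abelian_group.intro sharp_abelian_group[OF A])
  have "a \<oplus>\<^bsub>part (sharp S A) p\<^esub> b \<in> ob A (sobj p)" using abc P.a_closed by simp
  then have "act (sharp S A) p q (a \<oplus>\<^bsub>part (sharp S A) p\<^esub> b) c =
      ksign (part (sharp S A) (p + q)) (p * q)
        (act (sharp S A) q p c a \<oplus>\<^bsub>part (sharp S A) (q + p)\<^esub> act (sharp S A) q p c b)"
    using abc by (simp add: sharp_act_comm[OF A, of _ p c q] sharp_act_add[OF A])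
  also have "\<dots> = act (sharp S A) p q a c \<oplus>\<^bsub>part (sharp S A) (p + q)\<^esub> act (sharp S A) p q b c"
    using abc sharp_act_closed[OF A abc(3) abc(1)] sharp_act_closed[OF A abc(3) abc(2)]
    by (simp add: sharp_act_comm[OF A, of _ p c q] Q.ksign_add add.commute)
  finally show "act (sharp S A) p q (a \<oplus>\<^bsub>part (sharp S A) p\<^esub> b) c =
    act (sharp S A) p q a c \<oplus>\<^bsub>part (sharp S A) (p + q)\<^esub> act (sharp S A) p q b c" .
next
  fix p q r a b c
  assume abc: "a \<in> ob A (sobj p)" "b \<in> ob A (sobj q)" "c \<in> ob A (sobj r)"
  obtain X v where v: "assignment A X v"
    and x: "wt X p (TVar p 0)" "wt X q (TVar q (Suc 0))" "wt X r (TVar r 2)"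
    and abv: "term_op S A X p (TVar p 0) v = a" "term_op S A X q (TVar q (Suc 0)) v = b"
      "term_op S A X r (TVar r 2) v = c"
    by (rule three_variables[OF A abc])
  show "act (sharp S A) (p + q) r (act (sharp S A) p q a b) c =
      act (sharp S A) p (q + r) a (act (sharp S A) q r b c)"
    using term_op_teq[OF teq.mul_assoc[OF x], of A v] v x abv wt_TMul[OF x(1,2)] wt_TMul[OF x(2,3)]
      term_op_mul[OF A v x(1) wt_TMul[OF x(2,3) HOL.refl]]
      term_op_mul[OF A v wt_TMul[OF x(1,2) HOL.refl] x(3)]
    by (simp add: term_op_mul[OF A] add.assoc)
next
  fix q b assume b: "b \<in> ob A (sobj q)"
  obtain X v where v: "assignment A X v" and x: "wt X q (TVar q 0)"
    and bv: "term_op S A X q (TVar q 0) v = b"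
    using three_variables[OF A b b b] by metis
  show "act (sharp S A) 0 q (unt (sharp S A)) b = b"
    using term_op_teq[OF teq.mul_one[OF x], of A v] x bv term_op_mul[OF A v wt.intros(3) x]
    by (simp add: term_op_one[OF A v])
qed (auto simp: sharp_act_closed[OF A] sharp_act_add[OF A] intro: sharp_act_comm[OF A])

lemma sharp_module: "s_algebra S A \<Longrightarrow> super_module (sharp S A) (sharp S A)"
  by (intro super_module_self sharp_super_comm_ring)

lemma odd_square:
  assumes A: "s_algebra S A" and a: "a \<in> ob A (sobj 1)"
  shows "act (sharp S A) 1 1 a a = \<zero>\<^bsub>part (sharp S A) 0\<^esub>"
proof -
  obtain X v where v: "assignment A X v" and x: "wt X 1 (TVar 1 0)"
    and av: "term_op S A X 1 (TVar 1 0) v = a"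
    using three_variables[OF A a a a] by metis
  show ?thesis
    using term_op_teq[OF teq_odd_square[OF x], of A v] av term_op_mul[OF A v x x]
    by (simp add: term_op_zero[OF A v])
qed

text \<open>Homomorphisms of \<open>S\<close>-algebras commute with all operations, in particular with those that define the
  superalgebra structure.\<close>

lemma hom_term_op:
  assumes A: "s_algebra S A" and B: "s_algebra S B" and h: "salg_hom S A B h"
    and t: "wt X p t" and c: "assignment A X c"
  shows "h (sobj p) (term_op S A X p t c) = term_op S B X p t (\<lambda>q i. h (sobj q) (c q i))"
  unfolding term_op_def by (rule hom_app[OF A B h op_Hom[OF t] c])

lemma hom_ob: "salg_hom S A B h \<Longrightarrow> a \<in> ob A X \<Longrightarrow> h X a \<in> ob B X"
  by (auto simp: salg_hom_def)

lemma variable_of_pair: "i < sobj p u + sobj q u \<Longrightarrow> \<not> (u = p \<and> i = 0) \<Longrightarrow> u = q"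
  by (auto simp: sobj_def split: if_splits)

lemma hom_additive:
  assumes A: "s_algebra S A" and B: "s_algebra S B" and h: "salg_hom S A B h"
  shows "additive_on (part (sharp S A) p) (part (sharp S B) p) (h (sobj p))"
  unfolding additive_on_def sharp_carrier
proof (intro conjI ballI)
  show "h (sobj p) \<in> ob A (sobj p) \<rightarrow> ob B (sobj p)" using hom_ob[OF h] by blast
  fix a b assume ab: "a \<in> ob A (sobj p)" "b \<in> ob A (sobj p)"
  show "h (sobj p) (a \<oplus>\<^bsub>part (sharp S A) p\<^esub> b) = h (sobj p) a \<oplus>\<^bsub>part (sharp S B) p\<^esub> h (sobj p) b"
    unfolding sharp_add using ab
    by (subst hom_term_op[OF A B h])
      (auto dest: variable_of_pair intro!: wt.intros term_op_cong)
qed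

lemma hom_act:
  assumes A: "s_algebra S A" and B: "s_algebra S B" and h: "salg_hom S A B h"
    and ab: "a \<in> ob A (sobj p)" "b \<in> ob A (sobj q)" and r: "r = p + q"
  shows "h (sobj r) (act (sharp S A) p q a b) = act (sharp S B) p q (h (sobj p) a) (h (sobj q) b)"
proof -
  have t: "wt (padd (sobj p) (sobj q)) (p + q) (TMul (TVar p 0) (TVar q (second p q)))"
    by (intro wt.intros) (auto simp: second_def)
  show ?thesis
    unfolding sharp_act r using ab
    by (subst hom_term_op[OF A B h t])
      (auto dest: variable_of_pair intro!: term_op_cong[OF t])
qed

lemma hom_unt:
  assumes A: "s_algebra S A" and B: "s_algebra S B" and h: "salg_hom S A B h"
  shows "h (sobj 0) (unt (sharp S A)) = unt (sharp S B)"
  unfolding sharp_consts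
  by (subst hom_term_op[OF A B h]) (auto intro!: wt.intros term_op_cong)

lemma sharp_cst: "k \<in> Hom S zobj (sobj p) \<Longrightarrow> cst (sharp S A) p k = mor A k (tup S A zobj (\<lambda>_ _. undefined))"
  by (simp add: sharp_def app_mor)

lemma cst_closed: "s_algebra S A \<Longrightarrow> k \<in> Hom S zobj (sobj p) \<Longrightarrow> cst (sharp S A) p k \<in> ob A (sobj p)"
  by (auto simp: sharp_cst intro!: mor_ob tup_ob)

lemma hom_cst:
  assumes A: "s_algebra S A" and B: "s_algebra S B" and h: "salg_hom S A B h"
    and k: "k \<in> Hom S zobj (sobj p)"
  shows "h (sobj p) (cst (sharp S A) p k) = cst (sharp S B) p k"
proof -
  have "tup S B zobj (\<lambda>p i. h (sobj p) undefined) = tup S B zobj (\<lambda>_ _. undefined)"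
    by (rule tup_cong) simp
  then show ?thesis
    using hom_app[OF A B h k, of "\<lambda>_ _. undefined"] by (simp add: sharp_cst[OF k] app_mor[OF k])
qed

lemma ground_carrier [simp]: "carrier (part (ground S) p) = Hom S zobj (sobj p)"
  by (simp add: ground_def)

lemma ground_cst: "k \<in> Hom S zobj (sobj p) \<Longrightarrow> cst (ground S) p k = k"
  unfolding ground_def using tup_zobj[of "idn S zobj" zobj "\<lambda>_ _. undefined"]
  by (simp add: sharp_cst cmp_idn)

end

section \<open>Difference quotients and partial derivatives\<close>

locale super_fermat = super_theory S for S :: "('f, 'z) super_theory_scheme" +
  assumes fermat: "super_fermat_theory S"
begin

lemma even_quotient_ex1:
  assumes "f \<in> Hom S X (sobj q)" "i < X 0"
  shows "\<exists>!g. even_quotient S X q i f g"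
proof -
  have "\<forall>X q i. \<forall>f\<in>Hom S X (sobj q). i < X 0 \<longrightarrow> (\<exists>!g. even_quotient S X q i f g)"
    using fermat unfolding super_fermat_theory_def by (elim conjE)
  from this[rule_format, OF assms] show ?thesis .
qed

lemma odd_quotient_ex1:
  assumes "f \<in> Hom S X (sobj q)" "i < X 1"
  shows "\<exists>!h. odd_quotient S X q i f h"
proof -
  have "\<forall>X q i. \<forall>f\<in>Hom S X (sobj q). i < X 1 \<longrightarrow> (\<exists>!h. odd_quotient S X q i f h)"
    using fermat unfolding super_fermat_theory_def by (elim conjE)
  from this[rule_format, OF assms] show ?thesis .
qed

abbreviation Free :: "sdim \<Rightarrow> ('f, 'f) salg" where
  "Free X \<equiv> free_salg S X"

abbreviation Free_ring :: "sdim \<Rightarrow> ('f, 'f) super_alg" where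
  "Free_ring X \<equiv> sharp S (free_salg S X)"

abbreviation with_copy :: "sdim \<Rightarrow> bit \<Rightarrow> sdim" where
  "with_copy X p \<equiv> padd X (sobj p)"

sublocale F: super_module "Free_ring X" "Free_ring X" for X
  by (rule sharp_module[OF free_algebra])

lemma tup_Hom: "(\<And>p i. i < X p \<Longrightarrow> c p i \<in> Hom S Y (sobj p)) \<Longrightarrow> tup S (Free Y) X c \<in> Hom S Y X"
  by (rule tup_ob[OF free_algebra, unfolded free_simps]) simp

lemma prj_tup: "(\<And>p i. i < X p \<Longrightarrow> c p i \<in> Hom S Y (sobj p)) \<Longrightarrow> i < X p \<Longrightarrow>
    cmp S (prj S X p i) (tup S (Free Y) X c) = c p i"
  by (rule mor_prj_tup[OF free_algebra, unfolded free_simps]) simp_all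

lemma tup_cmp: "(\<And>p i. i < X p \<Longrightarrow> c p i \<in> Hom S Y (sobj p)) \<Longrightarrow> a \<in> Hom S Z Y \<Longrightarrow>
    cmp S (tup S (Free Y) X c) a = tup S (Free Z) X (\<lambda>p i. cmp S (c p i) a)"
  by (rule mor_tup[OF free_algebra, unfolded free_simps]) simp_all

text \<open>Substitution is evaluation in a free algebra, so it respects the superalgebra structure.\<close>

lemma cmp_additive: "a \<in> Hom S Z X \<Longrightarrow> additive_on (part (Free_ring X) q) (part (Free_ring Z) q) (\<lambda>f. cmp S f a)"
  using hom_additive[OF free_algebra free_algebra evaluation_hom[OF free_algebra], of a Z X q] by simp

lemmas cmp_add = additive_on_add[OF F.grp F.grp cmp_additive, unfolded sharp_carrier free_simps]
  and cmp_minus = additive_on_minus[OF F.grp F.grp cmp_additive, unfolded sharp_carrier free_simps]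
  and cmp_zero = additive_on_zero[OF F.grp F.grp cmp_additive]

lemma cmp_act: "a \<in> Hom S Z X \<Longrightarrow> f \<in> Hom S X (sobj p) \<Longrightarrow> g \<in> Hom S X (sobj q) \<Longrightarrow>
    cmp S (act (Free_ring X) p q f g) a = act (Free_ring Z) p q (cmp S f a) (cmp S g a)"
  using hom_act[OF free_algebra free_algebra evaluation_hom[OF free_algebra], of a Z X f p g q] by simp

lemma cmp_cst: "a \<in> Hom S Z X \<Longrightarrow> k \<in> Hom S zobj (sobj p) \<Longrightarrow> cmp S (cst (Free_ring X) p k) a = cst (Free_ring Z) p k"
  using hom_cst[OF free_algebra free_algebra evaluation_hom[OF free_algebra], of a Z X k p] by simp

text \<open>With \<open>x\<close> the variable \<open>(p, i)\<close> and \<open>y\<close> the additional one, composition with \<open>keep\<close> gives \<open>f(x, \<dots>)\<close> and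
  composition with \<open>move\<close> gives \<open>f(y, \<dots>)\<close>; the difference of the two is \<open>fdiff\<close>.  Composition with \<open>plug\<close>
  specialises \<open>y\<close>.\<close>

definition keep :: "sdim \<Rightarrow> bit \<Rightarrow> 'f" where
  "keep X p = tup S (Free (with_copy X p)) X (prj S (with_copy X p))"

definition move :: "sdim \<Rightarrow> bit \<Rightarrow> nat \<Rightarrow> 'f" where
  "move X p i = tup S (Free (with_copy X p)) X
    (\<lambda>r j. if r = p \<and> j = i then prj S (with_copy X p) p (X p) else prj S (with_copy X p) r j)"

definition plug :: "sdim \<Rightarrow> bit \<Rightarrow> 'f \<Rightarrow> 'f" where
  "plug X p t = tup S (Free X) (with_copy X p) (\<lambda>r j. if r = p \<and> j = X p then t else prj S X r j)"

definition replace :: "sdim \<Rightarrow> bit \<Rightarrow> nat \<Rightarrow> 'f \<Rightarrow> 'f" where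
  "replace X p i t = tup S (Free X) X (\<lambda>r j. if r = p \<and> j = i then t else prj S X r j)"

lemma prj_with_copy [simp]: "i < X r \<Longrightarrow> prj S (with_copy X p) r i \<in> Hom S (with_copy X p) (sobj r)"
  "prj S (with_copy X p) p (X p) \<in> Hom S (with_copy X p) (sobj p)"
  by (rule prj_Hom; simp)+

lemma keep_Hom [simp]: "keep X p \<in> Hom S (with_copy X p) X"
  unfolding keep_def by (rule tup_Hom) simp

lemma move_Hom [simp]: "move X p i \<in> Hom S (with_copy X p) X"
  unfolding move_def by (rule tup_Hom) auto

lemma with_copy_less: "j < X r + sobj p r \<Longrightarrow> \<not> (r = p \<and> j = X p) \<Longrightarrow> j < X r"
  by (auto simp: sobj_def split: if_splits)

lemma plug_arg: "t \<in> Hom S X (sobj p) \<Longrightarrow> j < with_copy X p r \<Longrightarrow>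
    (if r = p \<and> j = X p then t else prj S X r j) \<in> Hom S X (sobj r)"
  using prj_Hom[of j X r] with_copy_less[of j X r p] by auto

lemma plug_Hom [simp]: "t \<in> Hom S X (sobj p) \<Longrightarrow> plug X p t \<in> Hom S X (with_copy X p)"
  unfolding plug_def by (rule tup_Hom) (rule plug_arg)

lemma replace_Hom [simp]: "t \<in> Hom S X (sobj p) \<Longrightarrow> replace X p i t \<in> Hom S X X"
  unfolding replace_def by (rule tup_Hom) (auto intro: prj_Hom)

lemma prj_keep: "j < X r \<Longrightarrow> cmp S (prj S X r j) (keep X p) = prj S (with_copy X p) r j"
  unfolding keep_def by (rule prj_tup) auto

lemma prj_move: "j < X r \<Longrightarrow> cmp S (prj S X r j) (move X p i) =
    (if r = p \<and> j = i then prj S (with_copy X p) p (X p) else prj S (with_copy X p) r j)"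
  unfolding move_def by (rule prj_tup) auto

lemma prj_plug: "t \<in> Hom S X (sobj p) \<Longrightarrow> j < with_copy X p r \<Longrightarrow> cmp S (prj S (with_copy X p) r j) (plug X p t) =
    (if r = p \<and> j = X p then t else prj S X r j)"
  unfolding plug_def by (rule prj_tup) (rule plug_arg)

lemma prj_replace: "t \<in> Hom S X (sobj p) \<Longrightarrow> j < X r \<Longrightarrow> cmp S (prj S X r j) (replace X p i t) =
    (if r = p \<and> j = i then t else prj S X r j)"
  unfolding replace_def by (rule prj_tup) (auto intro: prj_Hom)

lemma Hom_eqI:
  assumes "f \<in> Hom S Z X" "g \<in> Hom S Z X"
    and "\<And>p i. i < X p \<Longrightarrow> cmp S (prj S X p i) f = cmp S (prj S X p i) g"
  shows "f = g"
  using ob_eqI[OF free_algebra, of f Z X g] assms by simp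

lemma prj_cmp: "j < X r \<Longrightarrow> a \<in> Hom S Y X \<Longrightarrow> b \<in> Hom S Z Y \<Longrightarrow>
    cmp S (prj S X r j) (cmp S a b) = cmp S (cmp S (prj S X r j) a) b"
  using cmp_assoc[of b Z Y a X "prj S X r j" "sobj r"] prj_Hom[of j X r] by simp

lemma keep_plug: assumes t: "t \<in> Hom S X (sobj p)"
  shows "cmp S (keep X p) (plug X p t) = idn S X"
proof (rule Hom_eqI)
  show "cmp S (keep X p) (plug X p t) \<in> Hom S X X" using t by (intro cmp_Hom[OF plug_Hom keep_Hom])
  fix r j assume j: "j < X r"
  then show "cmp S (prj S X r j) (cmp S (keep X p) (plug X p t)) = cmp S (prj S X r j) (idn S X)"
    using t by (auto simp: prj_cmp[OF j keep_Hom plug_Hom[OF t]] prj_keep prj_plug cmp_idn[OF prj_Hom[of j X r]])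
qed simp

lemma move_plug: assumes t: "t \<in> Hom S X (sobj p)"
  shows "cmp S (move X p i) (plug X p t) = replace X p i t"
proof (rule Hom_eqI)
  show "cmp S (move X p i) (plug X p t) \<in> Hom S X X" using t by (intro cmp_Hom[OF plug_Hom move_Hom])
  fix r j assume j: "j < X r"
  then show "cmp S (prj S X r j) (cmp S (move X p i) (plug X p t)) = cmp S (prj S X r j) (replace X p i t)"
    using t by (auto simp: prj_cmp[OF j move_Hom plug_Hom[OF t]] prj_move prj_plug prj_replace)
qed (simp add: t)

lemma fdiff_eq: "f \<in> Hom S X (sobj q) \<Longrightarrow>
    fdiff S X q p i f = cmp S f (keep X p) \<ominus>\<^bsub>part (Free_ring (with_copy X p)) q\<^esub> cmp S f (move X p i)"
  unfolding fdiff_def Let_def keep_def move_def by (simp add: app_mor)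

lemma vdiff_eq: "vdiff S X p i = prj S (with_copy X p) p i \<ominus>\<^bsub>part (Free_ring (with_copy X p)) p\<^esub> prj S (with_copy X p) p (X p)"
  unfolding vdiff_def Let_def ..

lemma minus_Hom [simp]: "f \<in> Hom S X (sobj q) \<Longrightarrow> g \<in> Hom S X (sobj q) \<Longrightarrow>
    f \<ominus>\<^bsub>part (Free_ring X) q\<^esub> g \<in> Hom S X (sobj q)"
  using F.grp.minus_closed[of f X q g] by simp

lemma add_Hom [simp]: "f \<in> Hom S X (sobj q) \<Longrightarrow> g \<in> Hom S X (sobj q) \<Longrightarrow>
    f \<oplus>\<^bsub>part (Free_ring X) q\<^esub> g \<in> Hom S X (sobj q)"
  using F.grp.a_closed[of f X q g] by simp

lemma zero_Hom [simp]: "\<zero>\<^bsub>part (Free_ring X) q\<^esub> \<in> Hom S X (sobj q)"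
  using F.grp.zero_closed[of X q] by simp

lemma act_Hom [simp]: "r = p + q \<Longrightarrow> f \<in> Hom S X (sobj p) \<Longrightarrow> g \<in> Hom S X (sobj q) \<Longrightarrow>
    act (Free_ring X) p q f g \<in> Hom S X (sobj r)"
  using F.act_closed[of r p q f X g] by simp

lemma vdiff_Hom [simp]: "i < X p \<Longrightarrow> vdiff S X p i \<in> Hom S (with_copy X p) (sobj p)"
  unfolding vdiff_eq by simp

lemma fdiff_Hom [simp]: "f \<in> Hom S X (sobj q) \<Longrightarrow> fdiff S X q p i f \<in> Hom S (with_copy X p) (sobj q)"
  by (simp add: fdiff_eq cmp_Hom[OF keep_Hom] cmp_Hom[OF move_Hom])

lemma vdiff_plug: "t \<in> Hom S X (sobj p) \<Longrightarrow> i < X p \<Longrightarrow>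
    cmp S (vdiff S X p i) (plug X p t) = prj S X p i \<ominus>\<^bsub>part (Free_ring X) p\<^esub> t"
  by (simp add: vdiff_eq cmp_minus[OF plug_Hom] prj_plug)

text \<open>Even and odd variables are treated alike by allowing the quotient to depend on \<open>x\<close> and \<open>y\<close> in both cases.  The
  quotient of the odd Fermat condition, which depends on the parameters only, is a particular one.\<close>

definition quotient :: "sdim \<Rightarrow> bit \<Rightarrow> bit \<Rightarrow> nat \<Rightarrow> 'f \<Rightarrow> 'f \<Rightarrow> bool" where
  "quotient X q p i f g \<longleftrightarrow> g \<in> Hom S (with_copy X p) (sobj (p + q)) \<and>
     fdiff S X q p i f = act (Free_ring (with_copy X p)) p (p + q) (vdiff S X p i) g"

abbreviation diag :: "sdim \<Rightarrow> bit \<Rightarrow> nat \<Rightarrow> 'f" where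
  "diag X p i \<equiv> plug X p (prj S X p i)"

lemma quotient_ex:
  assumes f: "f \<in> Hom S X (sobj q)" and i: "i < X p"
  shows "\<exists>g. quotient X q p i f g \<and> sderiv S X q p i f = cmp S g (diag X p i)"
proof (cases "p = 0")
  case True
  then have 0: "p = 0" .
  define g where "g = (THE g. even_quotient S X q i f g)"
  have "even_quotient S X q i f g"
    unfolding g_def using i 0 by (intro theI'[OF even_quotient_ex1[OF f]]) simp
  then have "quotient X q p i f g"
    unfolding even_quotient_def quotient_def Let_def using 0 by simp
  moreover have "sderiv S X q p i f = cmp S g (diag X p i)"
    using calculation unfolding 0 sderiv_def g_def[symmetric] quotient_def plug_def
    by (simp add: app_mor[of g "with_copy X 0" "sobj q"])
  ultimately show ?thesis by blast
next
  case False
  then have 1: "p = 1" by simp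
  let ?Y = "with_copy X 1" and ?W = "without_odd X"
  define h where "h = (THE h. odd_quotient S X q i f h)"
  have "odd_quotient S X q i f h"
    unfolding h_def using i 1 by (intro theI'[OF odd_quotient_ex1[OF f]]) simp
  then have h: "h \<in> Hom S ?W (sobj (1 + q))"
    and fd: "fdiff S X q 1 i f = act (Free_ring ?Y) 1 (1 + q) (vdiff S X 1 i) (app S (Free ?Y) h (skip_odd S ?Y i))"
    unfolding odd_quotient_def Let_def by auto
  have skip: "skip_odd S ?Y i r j \<in> Hom S ?Y (sobj r)" "cmp S (skip_odd S ?Y i r j) (diag X 1 i) = skip_odd S X i r j"
    if j: "j < ?W r" for r j
  proof -
    let ?j = "if r = 1 \<and> i \<le> j then Suc j else j"
    have "?j < X r" using j by (auto simp: without_odd_def split: if_splits)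
    then show "skip_odd S ?Y i r j \<in> Hom S ?Y (sobj r)"
      unfolding skip_odd_def by (intro prj_Hom) simp
    show "cmp S (skip_odd S ?Y i r j) (diag X 1 i) = skip_odd S X i r j"
      using \<open>?j < X r\<close> i unfolding skip_odd_def 1
      by (subst prj_plug) (auto intro: prj_Hom)
  qed
  let ?s = "tup S (Free ?Y) ?W (skip_odd S ?Y i)"
  have s: "?s \<in> Hom S ?Y ?W" by (rule tup_Hom[OF skip(1)])
  have d: "diag X 1 i \<in> Hom S X ?Y" using i 1 by (intro plug_Hom prj_Hom) simp
  have "quotient X q p i f (cmp S h ?s)"
    unfolding quotient_def 1 using fd h s by (simp add: app_mor[OF h] cmp_Hom[OF s h])
  moreover have "sderiv S X q p i f = cmp S (cmp S h ?s) (diag X p i)"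
  proof -
    have "cmp S ?s (diag X 1 i) = tup S (Free X) ?W (\<lambda>r j. cmp S (skip_odd S ?Y i r j) (diag X 1 i))"
      by (rule tup_cmp[OF _ d]) (rule skip(1))
    also have "\<dots> = tup S (Free X) ?W (skip_odd S X i)"
      by (rule tup_cong) (rule skip(2))
    finally show ?thesis
      using h s d unfolding 1 sderiv_def h_def[symmetric]
      by (simp add: app_mor[OF h] cmp_assoc[OF d s h, symmetric])
  qed
  ultimately show ?thesis by blast
qed

lemma fdiff_zero: "fdiff S X q p i \<zero>\<^bsub>part (Free_ring X) q\<^esub> = \<zero>\<^bsub>part (Free_ring (with_copy X p)) q\<^esub>"
  by (simp add: fdiff_eq cmp_zero[OF keep_Hom] cmp_zero[OF move_Hom])

lemma fdiff_plug:
  assumes f: "f \<in> Hom S X (sobj q)" and t: "t \<in> Hom S X (sobj p)"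
  shows "cmp S (fdiff S X q p i f) (plug X p t) = f \<ominus>\<^bsub>part (Free_ring X) q\<^esub> cmp S f (replace X p i t)"
  using cmp_assoc[OF plug_Hom[OF t] keep_Hom f] cmp_assoc[OF plug_Hom[OF t] move_Hom f]
  by (simp add: fdiff_eq[OF f] cmp_minus[OF plug_Hom[OF t]] cmp_Hom[OF _ f] keep_plug[OF t]
      move_plug[OF t] cmp_idn[OF f])

lemma quotient_plug:
  assumes "quotient X q p i f g" and f: "f \<in> Hom S X (sobj q)" and t: "t \<in> Hom S X (sobj p)" and i: "i < X p"
  shows "f \<ominus>\<^bsub>part (Free_ring X) q\<^esub> cmp S f (replace X p i t) =
    act (Free_ring X) p (p + q) (prj S X p i \<ominus>\<^bsub>part (Free_ring X) p\<^esub> t) (cmp S g (plug X p t))"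
  using assms(1) fdiff_plug[OF f t, of i] i t unfolding quotient_def
  by (simp add: cmp_act[OF plug_Hom[OF t]] vdiff_plug)

text \<open>For odd \<open>x\<close> and \<open>y\<close> a relation \<open>(x - y) k(x, y) = 0\<close> gives \<open>(x - y) k(x, x) = 0\<close>, because
  \<open>k(x, y) - k(x, x)\<close> is a multiple of \<open>y - x\<close> and \<open>(x - y)\<^sup>2 = 0\<close>.  Writing the same relation with another
  variable \<open>y'\<close> and subtracting gives \<open>(y - y') k(x, x) = 0\<close>, where \<open>x\<close> is now a parameter, so \<open>k(x, x) = 0\<close> by uniqueness of
  the odd quotient of zero.  For even \<open>x\<close> and \<open>y\<close> uniqueness of the quotient of zero gives \<open>k = 0\<close> at once.\<close>

lemma annihilated_by_vdiff:
  assumes k: "k \<in> Hom S (with_copy X p) (sobj q)" and i: "i < X p"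
    and vk: "act (Free_ring (with_copy X p)) p q (vdiff S X p i) k = \<zero>\<^bsub>part (Free_ring (with_copy X p)) (p + q)\<^esub>"
  shows "cmp S k (diag X p i) = \<zero>\<^bsub>part (Free_ring X) q\<^esub>"
proof (cases "p = 0")
  case True
  let ?z = "\<zero>\<^bsub>part (Free_ring X) q\<^esub>" and ?zz = "\<zero>\<^bsub>part (Free_ring (with_copy X p)) q\<^esub>"
  have "even_quotient S X q i ?z k" "even_quotient S X q i ?z ?zz"
    unfolding even_quotient_def Let_def using k vk fdiff_zero[of X q p i] i unfolding True by simp_all
  then have "k = ?zz" using even_quotient_ex1[of ?z X q i] i True by auto
  then show ?thesis using i by (simp add: cmp_zero[OF plug_Hom] prj_Hom)
next
  case False
  then have p: "p = 1" by simp
  let ?Y = "with_copy X 1"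
  let ?Z = "with_copy ?Y 1"
  \<comment> \<open>\<open>m(x) = k(x, x)\<close>, and \<open>m1\<close> is the same function with the variable \<open>y\<close> added\<close>
  let ?v = "vdiff S X 1 i" and ?m = "cmp S k (diag X 1 i)"
  let ?m1 = "cmp S ?m (keep X 1)"
  have i1: "i < X 1" and xi: "prj S X 1 i \<in> Hom S X (sobj 1)" using i p by (auto intro: prj_Hom)
  have k1: "k \<in> Hom S ?Y (sobj q)" using k p by simp
  have m: "?m \<in> Hom S X (sobj q)" using k p xi by (intro cmp_Hom[OF plug_Hom]) auto
  have m1: "?m1 \<in> Hom S ?Y (sobj q)" using m by (intro cmp_Hom[OF keep_Hom])
  have v: "?v \<in> Hom S ?Y (sobj 1)" using i1 by simp
  let ?x = "prj S ?Y 1 i" and ?y = "prj S ?Y 1 (X 1)"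
  have xy: "?x \<in> Hom S ?Y (sobj 1)" "?y \<in> Hom S ?Y (sobj 1)" "X 1 < ?Y 1" using i1 by auto
  obtain l where l: "quotient ?Y q 1 (X 1) k l" using quotient_ex[OF k1 xy(3)] by blast
  let ?l = "cmp S l (plug ?Y 1 ?x)"
  have l': "?l \<in> Hom S ?Y (sobj (1 + q))"
    using l unfolding quotient_def by (intro cmp_Hom[OF plug_Hom[OF xy(1)]]) simp
  have "replace ?Y 1 (X 1) ?x = cmp S (diag X 1 i) (keep X 1)"
  proof (rule Hom_eqI)
    show "cmp S (diag X 1 i) (keep X 1) \<in> Hom S ?Y ?Y" by (rule cmp_Hom[OF keep_Hom plug_Hom[OF xi]])
    fix r j assume j: "j < ?Y r"
    then have "r = 1 \<and> j = X 1 \<or> j < X r" using with_copy_less[of j X r 1] unfolding padd_apply by blast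
    then show "cmp S (prj S ?Y r j) (replace ?Y 1 (X 1) ?x) =
        cmp S (prj S ?Y r j) (cmp S (diag X 1 i) (keep X 1))"
      using i1 by (auto simp: prj_replace[OF xy(1) j] prj_cmp[OF j plug_Hom[OF xi] keep_Hom]
          prj_plug[OF xi j] prj_keep)
  qed (simp add: xy)
  then have "k \<ominus>\<^bsub>part (Free_ring ?Y) q\<^esub> ?m1 =
      act (Free_ring ?Y) 1 (1 + q) (?y \<ominus>\<^bsub>part (Free_ring ?Y) 1\<^esub> ?x) ?l"
    using quotient_plug[OF l k1 xy(1,3)] cmp_assoc[OF keep_Hom plug_Hom[OF xi] k1] by simp
  also have "?y \<ominus>\<^bsub>part (Free_ring ?Y) 1\<^esub> ?x = \<ominus>\<^bsub>part (Free_ring ?Y) 1\<^esub> ?v"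
    unfolding vdiff_eq using xy by (simp add: F.grp.inv_minus)
  finally have "act (Free_ring ?Y) 1 q ?v (k \<ominus>\<^bsub>part (Free_ring ?Y) q\<^esub> ?m1) =
      act (Free_ring ?Y) 1 q ?v (\<ominus>\<^bsub>part (Free_ring ?Y) q\<^esub> act (Free_ring ?Y) 1 (1 + q) ?v ?l)"
    using v l' F.inv_act[of q 1 "1 + q" ?l ?Y ?v] by simp
  also have "\<dots> = \<ominus>\<^bsub>part (Free_ring ?Y) (1 + q)\<^esub> act (Free_ring ?Y) 0 (1 + q) (act (Free_ring ?Y) 1 1 ?v ?v) ?l"
    using v l' F.act_inv[of "1 + q" 1 q ?v ?Y "act (Free_ring ?Y) 1 (1 + q) ?v ?l"] F.act_act[of 0 1 1 ?v ?Y ?v ?l "1 + q"]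
    by simp
  also have "act (Free_ring ?Y) 1 1 ?v ?v = \<zero>\<^bsub>part (Free_ring ?Y) 0\<^esub>" using v by (intro odd_square free_algebra) simp
  also have "\<ominus>\<^bsub>part (Free_ring ?Y) (1 + q)\<^esub> act (Free_ring ?Y) 0 (1 + q) (\<zero>\<^bsub>part (Free_ring ?Y) 0\<^esub>) ?l = \<zero>\<^bsub>part (Free_ring ?Y) (1 + q)\<^esub>"
    using l' by simp
  finally have vm1: "act (Free_ring ?Y) 1 q ?v ?m1 = \<zero>\<^bsub>part (Free_ring ?Y) (1 + q)\<^esub>"
    using vk v k1 m1 F.act_minus[of "1 + q" 1 q ?v ?Y k ?m1] p
    by (simp add: F.grp.zero_minus)
  \<comment> \<open>\<open>z'\<close> is the second copy of \<open>y\<close>, and \<open>m2\<close> is \<open>m\<close> with \<open>y\<close> and its copy added\<close>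
  let ?x' = "prj S ?Z 1 i" and ?y' = "prj S ?Z 1 (X 1)" and ?z' = "prj S ?Z 1 (?Y 1)"
  let ?kk = "cmp S (keep X 1) (keep ?Y 1)"
  let ?m2 = "cmp S ?m ?kk"
  have xyz: "?x' \<in> Hom S ?Z (sobj 1)" "?y' \<in> Hom S ?Z (sobj 1)" "?z' \<in> Hom S ?Z (sobj 1)"
    using i1 by (auto intro: prj_Hom)
  have kk: "?kk \<in> Hom S ?Z X" by (rule cmp_Hom[OF keep_Hom keep_Hom])
  have m2: "?m2 \<in> Hom S ?Z (sobj q)" by (rule cmp_Hom[OF kk m])
  have km: "cmp S (keep X 1) (move ?Y 1 (X 1)) = ?kk"
  proof (rule Hom_eqI)
    show "cmp S (keep X 1) (move ?Y 1 (X 1)) \<in> Hom S ?Z X" by (rule cmp_Hom[OF move_Hom keep_Hom])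
    fix r j assume j: "j < X r"
    then show "cmp S (prj S X r j) (cmp S (keep X 1) (move ?Y 1 (X 1))) = cmp S (prj S X r j) ?kk"
      by (auto simp: prj_cmp[of j X r, OF j keep_Hom move_Hom] prj_cmp[of j X r, OF j keep_Hom keep_Hom] prj_keep prj_move)
  qed (rule kk)
  have "cmp S ?v (keep ?Y 1) = ?x' \<ominus>\<^bsub>part (Free_ring ?Z) 1\<^esub> ?y'"
    using i1 xy by (simp add: vdiff_eq cmp_minus[OF keep_Hom] prj_keep)
  moreover have "cmp S ?v (move ?Y 1 (X 1)) = ?x' \<ominus>\<^bsub>part (Free_ring ?Z) 1\<^esub> ?z'"
    using i1 xy by (simp add: vdiff_eq cmp_minus[OF move_Hom] prj_move)
  moreover have "cmp S ?m1 (keep ?Y 1) = ?m2" by (rule cmp_assoc[OF keep_Hom keep_Hom m, symmetric])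
  moreover have "cmp S ?m1 (move ?Y 1 (X 1)) = ?m2"
    unfolding km[symmetric] by (rule cmp_assoc[OF move_Hom keep_Hom m, symmetric])
  ultimately have zero: "act (Free_ring ?Z) 1 q (?x' \<ominus>\<^bsub>part (Free_ring ?Z) 1\<^esub> ?y') ?m2 = \<zero>\<^bsub>part (Free_ring ?Z) (1 + q)\<^esub>"
     "act (Free_ring ?Z) 1 q (?x' \<ominus>\<^bsub>part (Free_ring ?Z) 1\<^esub> ?z') ?m2 = \<zero>\<^bsub>part (Free_ring ?Z) (1 + q)\<^esub>"
    using arg_cong[OF vm1, of "\<lambda>f. cmp S f (keep ?Y 1)"] arg_cong[OF vm1, of "\<lambda>f. cmp S f (move ?Y 1 (X 1))"]
    by (simp_all add: cmp_act[OF keep_Hom v m1] cmp_act[OF move_Hom v m1] cmp_zero[OF keep_Hom] cmp_zero[OF move_Hom])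
  have "vdiff S ?Y 1 (X 1) =
      (?x' \<ominus>\<^bsub>part (Free_ring ?Z) 1\<^esub> ?z') \<ominus>\<^bsub>part (Free_ring ?Z) 1\<^esub> (?x' \<ominus>\<^bsub>part (Free_ring ?Z) 1\<^esub> ?y')"
    unfolding vdiff_eq using xyz by (simp add: F.grp.minus_minus_minus)
  then have vm2: "act (Free_ring ?Z) 1 q (vdiff S ?Y 1 (X 1)) ?m2 = \<zero>\<^bsub>part (Free_ring ?Z) (1 + q)\<^esub>"
    using zero xyz m2 F.minus_act[of "1 + q" 1 q ?m2 ?Z "?x' \<ominus>\<^bsub>part (Free_ring ?Z) 1\<^esub> ?z'" "?x' \<ominus>\<^bsub>part (Free_ring ?Z) 1\<^esub> ?y'"]
    by simp
  have WY: "without_odd ?Y = X" by (auto simp: without_odd_def fun_eq_iff sobj_def)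
  have skip: "tup S (Free ?Z) X (skip_odd S ?Z (X 1)) = ?kk"
  proof (rule tup_eqI[OF free_algebra])
    fix r j assume j: "j < X r"
    then show "mor (Free ?Z) (prj S X r j) ?kk = skip_odd S ?Z (X 1) r j"
      by (auto simp: prj_cmp[of j X r, OF j keep_Hom keep_Hom] prj_keep skip_odd_def)
  qed (simp add: kk)
  \<comment> \<open>both \<open>m\<close> and zero are quotients of zero with respect to \<open>y\<close>\<close>
  let ?o = "\<zero>\<^bsub>part (Free_ring ?Y) (1 + q)\<^esub>" and ?o' = "\<zero>\<^bsub>part (Free_ring X) q\<^esub>"
  have "odd_quotient S ?Y (1 + q) (X 1) ?o ?m"
    unfolding odd_quotient_def Let_def WY fdiff_zero using m vm2 skip by (simp add: app_mor[OF m])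
  moreover have "odd_quotient S ?Y (1 + q) (X 1) ?o ?o'"
    unfolding odd_quotient_def Let_def WY fdiff_zero
    using skip xy(3) by (simp add: app_mor[OF zero_Hom] cmp_zero[OF kk])
  ultimately have "?m = ?o'"
    using odd_quotient_ex1[of ?o ?Y "1 + q" "X 1"] xy(3) by auto
  then show ?thesis unfolding p .
qed

text \<open>Hence any quotient, not only the normalised one of the odd condition, computes the derivative.\<close>

lemma sderiv_quotient:
  assumes f: "f \<in> Hom S X (sobj q)" and i: "i < X p" and g: "quotient X q p i f g"
  shows "sderiv S X q p i f = cmp S g (diag X p i)"
proof -
  obtain g' where g': "quotient X q p i f g'" and d: "sderiv S X q p i f = cmp S g' (diag X p i)"
    using quotient_ex[OF f i] by blast
  have H: "g \<in> Hom S (with_copy X p) (sobj (p + q))" "g' \<in> Hom S (with_copy X p) (sobj (p + q))"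
    using g g' by (auto simp: quotient_def)
  have diag: "diag X p i \<in> Hom S X (with_copy X p)" using i by (intro plug_Hom prj_Hom)
  have "act (Free_ring (with_copy X p)) p (p + q) (vdiff S X p i) (g' \<ominus>\<^bsub>part (Free_ring (with_copy X p)) (p + q)\<^esub> g) =
      \<zero>\<^bsub>part (Free_ring (with_copy X p)) q\<^esub>"
    using F.act_minus[of q p "p + q" "vdiff S X p i" "with_copy X p" g' g] H i g g' fdiff_Hom[OF f, of p i]
    by (simp add: quotient_def)
  then have "cmp S (g' \<ominus>\<^bsub>part (Free_ring (with_copy X p)) (p + q)\<^esub> g) (diag X p i) = \<zero>\<^bsub>part (Free_ring X) (p + q)\<^esub>"
    using H i by (intro annihilated_by_vdiff) simp_all
  then show ?thesis
    using H cmp_Hom[OF diag H(1)] cmp_Hom[OF diag H(2)] d F.grp.minus_eq_zero[of "cmp S g' (diag X p i)" X "p + q"]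
    by (simp add: cmp_minus[OF diag])
qed

section \<open>The rules of differentiation\<close>

lemma diag_Hom: "i < X p \<Longrightarrow> diag X p i \<in> Hom S X (with_copy X p)"
  by (intro plug_Hom prj_Hom)

lemma cmp_keep_diag: "f \<in> Hom S X Y \<Longrightarrow> i < X p \<Longrightarrow> cmp S (cmp S f (keep X p)) (diag X p i) = f"
  using cmp_assoc[OF diag_Hom keep_Hom, of i X p f Y] by (simp add: keep_plug prj_Hom cmp_idn)

lemma replace_self: "i < X p \<Longrightarrow> replace X p i (prj S X p i) = idn S X"
  unfolding replace_def tup_prj[symmetric] by (rule tup_cong) auto

lemma cmp_move_diag: "f \<in> Hom S X Y \<Longrightarrow> i < X p \<Longrightarrow> cmp S (cmp S f (move X p i)) (diag X p i) = f"
  using cmp_assoc[OF diag_Hom move_Hom, of i X p f Y i] by (simp add: move_plug prj_Hom cmp_idn replace_self)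

lemma sderiv_Hom: "f \<in> Hom S X (sobj q) \<Longrightarrow> i < X p \<Longrightarrow> sderiv S X q p i f \<in> Hom S X (sobj (p + q))"
  using quotient_ex[of f X q i p] cmp_Hom[OF diag_Hom] unfolding quotient_def by metis

text \<open>Hadamard's lemma to first order: the defining equation of a quotient, with \<open>t\<close> put for \<open>y\<close>.\<close>

lemma hadamard:
  assumes f: "f \<in> Hom S X (sobj q)" and t: "t \<in> Hom S X (sobj p)" and i: "i < X p"
  shows "\<exists>g \<in> Hom S X (sobj (p + q)). f = cmp S f (replace X p i t) \<oplus>\<^bsub>part (Free_ring X) q\<^esub>
    act (Free_ring X) p (p + q) (prj S X p i \<ominus>\<^bsub>part (Free_ring X) p\<^esub> t) g"
proof -
  obtain g where g: "quotient X q p i f g" using quotient_ex[OF f i] by blast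
  have gH: "cmp S g (plug X p t) \<in> Hom S X (sobj (p + q))"
    using g unfolding quotient_def by (intro cmp_Hom[OF plug_Hom[OF t]]) simp
  have fr: "cmp S f (replace X p i t) \<in> Hom S X (sobj q)" by (rule cmp_Hom[OF replace_Hom[OF t] f])
  have "f = (f \<ominus>\<^bsub>part (Free_ring X) q\<^esub> cmp S f (replace X p i t)) \<oplus>\<^bsub>part (Free_ring X) q\<^esub> cmp S f (replace X p i t)"
    using f fr F.grp.minus_add_cancel[of f X q "cmp S f (replace X p i t)"] by simp
  also have "\<dots> = cmp S f (replace X p i t) \<oplus>\<^bsub>part (Free_ring X) q\<^esub> (f \<ominus>\<^bsub>part (Free_ring X) q\<^esub> cmp S f (replace X p i t))"
    using f fr by (intro F.grp.a_comm) simp_all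
  finally show ?thesis using gH unfolding quotient_plug[OF g f t i] by blast
qed

lemma sderiv_eq_zero:
  assumes f: "f \<in> Hom S X (sobj q)" and i: "i < X p" and eq: "cmp S f (keep X p) = cmp S f (move X p i)"
  shows "sderiv S X q p i f = \<zero>\<^bsub>part (Free_ring X) (p + q)\<^esub>"
proof -
  have "quotient X q p i f \<zero>\<^bsub>part (Free_ring (with_copy X p)) (p + q)\<^esub>"
    unfolding quotient_def using i cmp_Hom[OF move_Hom f] by (simp add: fdiff_eq[OF f] eq)
  then show ?thesis by (simp add: sderiv_quotient[OF f i] cmp_zero[OF diag_Hom[of i X p, OF i]])
qed

lemma sderiv_cst:
  "k \<in> Hom S zobj (sobj q) \<Longrightarrow> i < X p \<Longrightarrow> sderiv S X q p i (cst (Free_ring X) q k) = \<zero>\<^bsub>part (Free_ring X) (p + q)\<^esub>"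
  using cst_closed[OF free_algebra, of k q X]
  by (intro sderiv_eq_zero) (simp_all add: cmp_cst[OF keep_Hom] cmp_cst[OF move_Hom])

lemma sderiv_prj_other: "j < X r \<Longrightarrow> i < X p \<Longrightarrow> \<not> (r = p \<and> j = i) \<Longrightarrow>
    sderiv S X r p i (prj S X r j) = \<zero>\<^bsub>part (Free_ring X) (p + r)\<^esub>"
  by (intro sderiv_eq_zero) (auto simp: prj_Hom prj_keep prj_move)

lemma sderiv_prj_same:
  assumes i: "i < X p"
  shows "sderiv S X p p i (prj S X p i) = unt (Free_ring X)"
proof -
  have x: "prj S X p i \<in> Hom S X (sobj p)" using i by (rule prj_Hom)
  have "quotient X p p i (prj S X p i) (unt (Free_ring (with_copy X p)))"
    unfolding quotient_def using i vdiff_Hom[of i X p, OF i] F.mult_unt[of "vdiff S X p i" "with_copy X p" p] F.unt_closed[of "with_copy X p"]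
    by (simp add: fdiff_eq[OF x] prj_keep prj_move vdiff_eq)
  then show ?thesis
    using hom_unt[OF free_algebra free_algebra evaluation_hom[OF free_algebra], of "diag X p i" X "with_copy X p"] i
    by (simp add: sderiv_quotient[OF x i] diag_Hom)
qed

lemma sderiv_add:
  assumes f: "f \<in> Hom S X (sobj q)" and g: "g \<in> Hom S X (sobj q)" and i: "i < X p"
  shows "sderiv S X q p i (f \<oplus>\<^bsub>part (Free_ring X) q\<^esub> g) =
    sderiv S X q p i f \<oplus>\<^bsub>part (Free_ring X) (p + q)\<^esub> sderiv S X q p i g"
proof -
  let ?Y = "with_copy X p"
  obtain F where F: "quotient X q p i f F" using quotient_ex[OF f i] by blast
  obtain G where G: "quotient X q p i g G" using quotient_ex[OF g i] by blast
  have H: "F \<in> Hom S ?Y (sobj (p + q))" "G \<in> Hom S ?Y (sobj (p + q))"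
    using F G unfolding quotient_def by auto
  note K = cmp_Hom[OF keep_Hom f, of p] cmp_Hom[OF keep_Hom g, of p]
    cmp_Hom[OF move_Hom f, of p i] cmp_Hom[OF move_Hom g, of p i]
  have fg: "f \<oplus>\<^bsub>part (Free_ring X) q\<^esub> g \<in> Hom S X (sobj q)" using f g by simp
  have "fdiff S X q p i (f \<oplus>\<^bsub>part (Free_ring X) q\<^esub> g) = fdiff S X q p i f \<oplus>\<^bsub>part (Free_ring ?Y) q\<^esub> fdiff S X q p i g"
    using K f g
    by (simp add: fdiff_eq cmp_add[OF keep_Hom] cmp_add[OF move_Hom] F.grp.add_minus_add)
  also have "\<dots> = act (Free_ring ?Y) p (p + q) (vdiff S X p i) (F \<oplus>\<^bsub>part (Free_ring ?Y) (p + q)\<^esub> G)"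
    using F G H i F.act_add[of q p "p + q" "vdiff S X p i" ?Y F G] unfolding quotient_def by simp
  finally have "quotient X q p i (f \<oplus>\<^bsub>part (Free_ring X) q\<^esub> g) (F \<oplus>\<^bsub>part (Free_ring ?Y) (p + q)\<^esub> G)"
    using H unfolding quotient_def by simp
  then show ?thesis
    using H by (simp add: sderiv_quotient[OF fg i] sderiv_quotient[OF f i F] sderiv_quotient[OF g i G]
        cmp_add[OF diag_Hom[of i X p, OF i]])
qed

lemma ksign_Hom [simp]: "f \<in> Hom S X (sobj q) \<Longrightarrow> ksign (part (Free_ring X) q) r f \<in> Hom S X (sobj q)"
  using F.grp.ksign_closed[of f X q r] by simp

text \<open>The quotient comes from \<open>f(x) g(x) - f(y) g(y) = (f(x) - f(y)) g(x) + f(y) (g(x) - g(y))\<close>; the sign arises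
  when \<open>x - y\<close> is moved to the left past \<open>f(y)\<close>.\<close>

lemma sderiv_mult:
  assumes f: "f \<in> Hom S X (sobj q)" and g: "g \<in> Hom S X (sobj r)" and i: "i < X p"
  shows "sderiv S X (q + r) p i (act (Free_ring X) q r f g) =
    act (Free_ring X) (p + q) r (sderiv S X q p i f) g \<oplus>\<^bsub>part (Free_ring X) (p + (q + r))\<^esub>
    ksign (part (Free_ring X) (p + (q + r))) (p * q) (act (Free_ring X) q (p + r) f (sderiv S X r p i g))"
proof -
  let ?Y = "with_copy X p"
  obtain F where F: "quotient X q p i f F" using quotient_ex[OF f i] by blast
  obtain G where G: "quotient X r p i g G" using quotient_ex[OF g i] by blast
  let ?v = "vdiff S X p i"
  let ?fx = "cmp S f (keep X p)" and ?fy = "cmp S f (move X p i)"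
    and ?gx = "cmp S g (keep X p)" and ?gy = "cmp S g (move X p i)"
  have H: "F \<in> Hom S ?Y (sobj (p + q))" "G \<in> Hom S ?Y (sobj (p + r))" "?v \<in> Hom S ?Y (sobj p)"
    using F G i unfolding quotient_def by auto
  note K = cmp_Hom[OF keep_Hom f, of p] cmp_Hom[OF keep_Hom g, of p]
    cmp_Hom[OF move_Hom f, of p i] cmp_Hom[OF move_Hom g, of p i]
  have dF: "?fx \<ominus>\<^bsub>part (Free_ring ?Y) q\<^esub> ?fy = act (Free_ring ?Y) p (p + q) ?v F"
    and dG: "?gx \<ominus>\<^bsub>part (Free_ring ?Y) r\<^esub> ?gy = act (Free_ring ?Y) p (p + r) ?v G"
    using F G f g unfolding quotient_def by (simp_all add: fdiff_eq)
  let ?H1 = "act (Free_ring ?Y) (p + q) r F ?gx" and ?H2 = "act (Free_ring ?Y) q (p + r) ?fy G"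
  let ?P = "part (Free_ring ?Y) (p + (q + r))"
  let ?H = "?H1 \<oplus>\<^bsub>?P\<^esub> ksign ?P (p * q) ?H2"
  have HH: "?H1 \<in> Hom S ?Y (sobj (p + (q + r)))" "?H2 \<in> Hom S ?Y (sobj (p + (q + r)))"
    using H K by (intro act_Hom; simp add: add.assoc add.left_commute)+
  have fg: "act (Free_ring X) q r f g \<in> Hom S X (sobj (q + r))" using f g by simp
  have "fdiff S X (q + r) p i (act (Free_ring X) q r f g) =
      act (Free_ring ?Y) q r ?fx ?gx \<ominus>\<^bsub>part (Free_ring ?Y) (q + r)\<^esub> act (Free_ring ?Y) q r ?fy ?gy"
    using f g by (simp add: fdiff_eq[OF fg] cmp_act[OF keep_Hom f g] cmp_act[OF move_Hom f g])
  also have "\<dots> = (act (Free_ring ?Y) q r ?fx ?gx \<ominus>\<^bsub>part (Free_ring ?Y) (q + r)\<^esub> act (Free_ring ?Y) q r ?fy ?gx)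
      \<oplus>\<^bsub>part (Free_ring ?Y) (q + r)\<^esub> (act (Free_ring ?Y) q r ?fy ?gx \<ominus>\<^bsub>part (Free_ring ?Y) (q + r)\<^esub> act (Free_ring ?Y) q r ?fy ?gy)"
    using K by (intro F.grp.minus_trans[symmetric]) simp_all
  also have "act (Free_ring ?Y) q r ?fx ?gx \<ominus>\<^bsub>part (Free_ring ?Y) (q + r)\<^esub> act (Free_ring ?Y) q r ?fy ?gx =
      act (Free_ring ?Y) q r (act (Free_ring ?Y) p (p + q) ?v F) ?gx"
    unfolding dF[symmetric] using K by (intro F.minus_act[symmetric]) simp_all
  also have "\<dots> = act (Free_ring ?Y) p (p + (q + r)) ?v ?H1"
    using F.act_act[of q p "p + q" ?v ?Y F ?gx r] H K by (simp add: add.assoc)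
  also have "act (Free_ring ?Y) q r ?fy ?gx \<ominus>\<^bsub>part (Free_ring ?Y) (q + r)\<^esub> act (Free_ring ?Y) q r ?fy ?gy =
      act (Free_ring ?Y) q r ?fy (act (Free_ring ?Y) p (p + r) ?v G)"
    unfolding dG[symmetric] using K by (intro F.act_minus[symmetric]) simp_all
  also have "\<dots> = ksign (part (Free_ring ?Y) (q + r)) (q * p) (act (Free_ring ?Y) p (p + (q + r)) ?v ?H2)"
    using H K by (intro F.act_left_commute) (simp_all add: add.left_commute add.assoc)
  also have "\<dots> = act (Free_ring ?Y) p (p + (q + r)) ?v (ksign ?P (p * q) ?H2)"
    using H HH F.act_ksign[of "q + r" p "p + (q + r)" ?v ?Y ?H2 "p * q"] by (simp add: mult.commute)
  also have "act (Free_ring ?Y) p (p + (q + r)) ?v ?H1 \<oplus>\<^bsub>part (Free_ring ?Y) (q + r)\<^esub> \<dots> =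
      act (Free_ring ?Y) p (p + (q + r)) ?v ?H"
    using H HH by (intro F.act_add[symmetric]) simp_all
  finally have "quotient X (q + r) p i (act (Free_ring X) q r f g) ?H"
    using HH unfolding quotient_def by simp
  moreover have d: "diag X p i \<in> Hom S X ?Y" using i by (rule diag_Hom)
  ultimately show ?thesis
    using H HH K additive_on_ksign[OF F.grp F.grp cmp_additive[OF d], of ?H2 "p + (q + r)" "p * q"]
    by (simp add: sderiv_quotient[OF fg i] sderiv_quotient[OF f i F] sderiv_quotient[OF g i G]
        cmp_add[OF d] cmp_act[OF d] cmp_keep_diag[OF g i] cmp_move_diag[OF f i])
qed

section \<open>Values at points of the ground ring\<close>

lemma ground_eq: "ground S = Free_ring zobj"
  by (simp add: ground_def)

lemma bang_Hom: "tup S (Free X) zobj c \<in> Hom S X zobj"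
  by (rule tup_Hom) simp

text \<open>A tuple of constants factors through the object \<open>(0|0)\<close>, so its composite with \<open>f\<close> does, too.\<close>

lemma constant_arrow:
  assumes f: "f \<in> Hom S X (sobj q)" and k: "\<And>r j. j < X r \<Longrightarrow> k r j \<in> Hom S zobj (sobj r)"
  shows "\<exists>c\<in>Hom S zobj (sobj q). cmp S f (tup S (Free X) X (\<lambda>r j. cst (Free_ring X) r (k r j))) = cst (Free_ring X) q c"
proof
  let ?b = "tup S (Free X) zobj (\<lambda>_ _. undefined)" and ?t = "tup S (Free zobj) X k"
  have t: "?t \<in> Hom S zobj X" by (rule tup_Hom[OF k])
  show c: "cmp S f ?t \<in> Hom S zobj (sobj q)" by (rule cmp_Hom[OF t f])
  have "cmp S ?t ?b = tup S (Free X) X (\<lambda>r j. cmp S (k r j) ?b)" by (rule tup_cmp[OF k bang_Hom])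
  also have "\<dots> = tup S (Free X) X (\<lambda>r j. cst (Free_ring X) r (k r j))"
    by (rule tup_cong) (simp add: sharp_cst[OF k])
  finally show "cmp S f (tup S (Free X) X (\<lambda>r j. cst (Free_ring X) r (k r j))) = cst (Free_ring X) q (cmp S f ?t)"
    using cmp_assoc[OF bang_Hom[of X "\<lambda>_ _. undefined"] t f] by (simp add: sharp_cst[OF c])
qed

text \<open>Hadamard's lemma replaces one variable at a time by its value; \<open>V\<close> is the set of the variables that have
  been replaced so far.\<close>

definition partial_subst :: "sdim \<Rightarrow> (bit \<Rightarrow> nat \<Rightarrow> 'f) \<Rightarrow> (bit \<times> nat) set \<Rightarrow> 'f" where
  "partial_subst X k V = tup S (Free X) X (\<lambda>r j. if (r, j) \<in> V then cst (Free_ring X) r (k r j) else prj S X r j)"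

context
  fixes X :: sdim and k :: "bit \<Rightarrow> nat \<Rightarrow> 'f"
  assumes k: "\<And>r j. j < X r \<Longrightarrow> k r j \<in> Hom S zobj (sobj r)"
begin

lemma cst_Hom: "j < X r \<Longrightarrow> cst (Free_ring X) r (k r j) \<in> Hom S X (sobj r)"
  using cst_closed[OF free_algebra k] by simp

lemma partial_subst_arg:
  "j < X r \<Longrightarrow> (if (r, j) \<in> V then cst (Free_ring X) r (k r j) else prj S X r j) \<in> Hom S X (sobj r)"
  using cst_Hom by (auto intro: prj_Hom)

lemma partial_subst_Hom: "partial_subst X k V \<in> Hom S X X"
  unfolding partial_subst_def by (rule tup_Hom) (rule partial_subst_arg)

lemma prj_partial_subst: "j < X r \<Longrightarrow> cmp S (prj S X r j) (partial_subst X k V) =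
    (if (r, j) \<in> V then cst (Free_ring X) r (k r j) else prj S X r j)"
  unfolding partial_subst_def by (rule prj_tup) (rule partial_subst_arg)

lemma partial_subst_insert:
  assumes i: "i < X p"
  shows "partial_subst X k (insert (p, i) V) = cmp S (partial_subst X k V) (replace X p i (cst (Free_ring X) p (k p i)))"
proof (rule Hom_eqI)
  note R = replace_Hom[OF cst_Hom[OF i]]
  show "cmp S (partial_subst X k V) (replace X p i (cst (Free_ring X) p (k p i))) \<in> Hom S X X"
    by (rule cmp_Hom[OF R partial_subst_Hom])
  fix r j assume j: "j < X r"
  show "cmp S (prj S X r j) (partial_subst X k (insert (p, i) V)) =
      cmp S (prj S X r j) (cmp S (partial_subst X k V) (replace X p i (cst (Free_ring X) p (k p i))))"
    using j by (auto simp: prj_cmp[of j X r, OF j partial_subst_Hom R] prj_partial_subst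
        prj_replace[OF cst_Hom[OF i]] cmp_cst[OF R k])
qed (rule partial_subst_Hom)

end

end

section \<open>The defect of the chain rule\<close>

locale derivation = super_fermat S for S :: "('f, 'z) super_theory_scheme" +
  fixes A :: "('f, 'a) salg" and M :: "('a, 'm) super_module" and D :: "bit \<Rightarrow> 'a \<Rightarrow> 'm"
  assumes A: "s_algebra S A" and is_module: "is_super_module (sharp S A) M"
    and derivation: "alg_derivation (ground S) (sharp S A) M D"
begin

sublocale A: super_module "sharp S A" "sharp S A"
  by (rule sharp_module[OF A])

sublocale M: super_module "sharp S A" M
  by (intro super_module.intro sharp_super_comm_ring A is_module)

lemmas act_ob = A.act_closed[unfolded sharp_carrier]

lemma D_additive: "additive_on (part (sharp S A) p) (part M p) (D p)"
  using derivation unfolding alg_derivation_def additive_on_def by blast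

lemmas D_closed = additive_on_closed[OF A.grp M.grp D_additive, unfolded sharp_carrier]
  and D_add = additive_on_add[OF A.grp M.grp D_additive, unfolded sharp_carrier]

lemma D_mult:
  assumes "a \<in> ob A (sobj p)" "b \<in> ob A (sobj q)"
  shows "D (p + q) (act (sharp S A) p q a b) =
    act M p q a (D q b) \<oplus>\<^bsub>part M (p + q)\<^esub> ksign (part M (p + q)) (p * q) (act M q p b (D p a))"
proof -
  have "\<forall>p q. \<forall>a\<in>carrier (part (sharp S A) p). \<forall>b\<in>carrier (part (sharp S A) q).
        D (p + q) (act (sharp S A) p q a b) = act M p q a (D q b) \<oplus>\<^bsub>part M (p + q)\<^esub> ract M p q (D p a) b"
    using derivation unfolding alg_derivation_def by (elim conjE)
  from this[rule_format, of a p b q] assms show ?thesis by (simp add: ract_def)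
qed

lemma D_unt: "D 0 (unt (sharp S A)) = \<zero>\<^bsub>part M 0\<^esub>"
  using D_mult[of "unt (sharp S A)" 0 "unt (sharp S A)" 0] A.unt_closed D_closed[of "unt (sharp S A)" 0]
  by simp

lemma D_cst:
  assumes k: "k \<in> Hom S zobj (sobj p)"
  shows "D p (cst (sharp S A) p k) = \<zero>\<^bsub>part M p\<^esub>"
proof -
  note c = cst_closed[OF A k]
  have "\<forall>p q. \<forall>k\<in>carrier (part (ground S) p). \<forall>a\<in>carrier (part (sharp S A) q).
      D (p + q) (act (sharp S A) p q (cst (sharp S A) p k) a) = act M p q (cst (sharp S A) p k) (D q a)"
    using derivation unfolding alg_derivation_def by (elim conjE)
  from this[rule_format, of k p "unt (sharp S A)" 0] k c A.unt_closed show ?thesis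
    by (simp add: D_unt A.mult_unt)
qed

definition vars :: "sdim \<Rightarrow> (bit \<times> nat) set" where
  "vars X = (SIGMA p:{0, 1}. {..<X p})"

lemma in_vars: "(p, i) \<in> vars X \<longleftrightarrow> i < X p"
  by (cases p) (auto simp: vars_def)

lemma finite_vars [simp]: "finite (vars X)"
  by (simp add: vars_def)

definition summand :: "sdim \<Rightarrow> 'a \<Rightarrow> bit \<Rightarrow> 'f \<Rightarrow> bit \<times> nat \<Rightarrow> 'm" where
  "summand X a q f = (\<lambda>(p, i). ract M p (p + q) (D p (mor A (prj S X p i) a)) (mor A (sderiv S X q p i f) a))"

text \<open>The right-hand side of the chain rule for \<open>D\<close>, that is, the coefficient of epsilon which the square-zero
  extension prescribes for \<open>f\<close> at \<open>a + epsilon D(a)\<close>.\<close>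

definition chain :: "sdim \<Rightarrow> 'a \<Rightarrow> bit \<Rightarrow> 'f \<Rightarrow> 'm" where
  "chain X a q f = finsum (part M q) (summand X a q f) (vars X)"

text \<open>\<open>D\<close> is an \<open>S\<close>-algebra derivation if and only if this vanishes for all operations and arguments.\<close>

definition defect :: "sdim \<Rightarrow> 'a \<Rightarrow> bit \<Rightarrow> 'f \<Rightarrow> 'm" where
  "defect X a q f = D q (mor A f a) \<ominus>\<^bsub>part M q\<^esub> chain X a q f"

context
  fixes X :: sdim and a :: 'a
  assumes a: "a \<in> ob A X"
begin

lemma ev_ob [simp]: "f \<in> Hom S X (sobj q) \<Longrightarrow> mor A f a \<in> ob A (sobj q)"
  by (rule mor_ob[OF A _ a])

lemma ev_additive: "additive_on (part (Free_ring X) q) (part (sharp S A) q) (\<lambda>f. mor A f a)"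
  using hom_additive[OF free_algebra A evaluation_hom[OF A a], of q] by simp

lemmas ev_add = additive_on_add[OF F.grp A.grp ev_additive, unfolded sharp_carrier free_simps]
  and ev_minus = additive_on_minus[OF F.grp A.grp ev_additive, unfolded sharp_carrier free_simps]
  and ev_ksign = additive_on_ksign[OF F.grp A.grp ev_additive, unfolded sharp_carrier free_simps]
  and ev_zero = additive_on_zero[OF F.grp A.grp ev_additive]

lemma ev_act: "r = p + q \<Longrightarrow> f \<in> Hom S X (sobj p) \<Longrightarrow> g \<in> Hom S X (sobj q) \<Longrightarrow>
    mor A (act (Free_ring X) p q f g) a = act (sharp S A) p q (mor A f a) (mor A g a)"
  using hom_act[OF free_algebra A evaluation_hom[OF A a], of f p g q r] by simp

lemma ev_cst: "k \<in> Hom S zobj (sobj p) \<Longrightarrow> mor A (cst (Free_ring X) p k) a = cst (sharp S A) p k"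
  using hom_cst[OF free_algebra A evaluation_hom[OF A a], of k p] by simp

lemma ev_unt: "mor A (unt (Free_ring X)) a = unt (sharp S A)"
  using hom_unt[OF free_algebra A evaluation_hom[OF A a]] by simp

lemma u_closed [simp]: "i < X p \<Longrightarrow> D p (mor A (prj S X p i) a) \<in> carrier (part M p)"
  by (intro D_closed ev_ob prj_Hom)

lemma summand_closed [simp]: "f \<in> Hom S X (sobj q) \<Longrightarrow> summand X a q f \<in> vars X \<rightarrow> carrier (part M q)"
  by (auto simp: summand_def in_vars intro!: M.ract_closed ev_ob sderiv_Hom)

lemma chain_closed [simp]: "f \<in> Hom S X (sobj q) \<Longrightarrow> chain X a q f \<in> carrier (part M q)"
  unfolding chain_def by (intro M.grp.finsum_closed summand_closed)

lemma chain_eq_zero: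
  assumes "\<And>p i. i < X p \<Longrightarrow> sderiv S X q p i f = \<zero>\<^bsub>part (Free_ring X) (p + q)\<^esub>"
  shows "chain X a q f = \<zero>\<^bsub>part M q\<^esub>"
  unfolding chain_def
proof (rule M.grp.add.finprod_one_eqI)
  fix v assume "v \<in> vars X"
  then show "summand X a q f v = \<zero>\<^bsub>part M q\<^esub>"
    by (cases v) (simp add: summand_def in_vars assms ev_zero)
qed

lemma chain_add:
  assumes f: "f \<in> Hom S X (sobj q)" and g: "g \<in> Hom S X (sobj q)"
  shows "chain X a q (f \<oplus>\<^bsub>part (Free_ring X) q\<^esub> g) = chain X a q f \<oplus>\<^bsub>part M q\<^esub> chain X a q g"
proof -
  have "chain X a q (f \<oplus>\<^bsub>part (Free_ring X) q\<^esub> g) =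
      finsum (part M q) (\<lambda>v. summand X a q f v \<oplus>\<^bsub>part M q\<^esub> summand X a q g v) (vars X)"
    unfolding chain_def
  proof (rule M.grp.finsum_cong'[OF HOL.refl])
    show "(\<lambda>v. summand X a q f v \<oplus>\<^bsub>part M q\<^esub> summand X a q g v) \<in> vars X \<rightarrow> carrier (part M q)"
      using summand_closed[OF f] summand_closed[OF g] by (intro Pi_I M.grp.a_closed; blast)
    fix v assume v: "v \<in> vars X"
    obtain p i where [simp]: "v = (p, i)" by (cases v)
    have i: "i < X p" using v by (simp add: in_vars)
    show "summand X a q (f \<oplus>\<^bsub>part (Free_ring X) q\<^esub> g) v = summand X a q f v \<oplus>\<^bsub>part M q\<^esub> summand X a q g v"
      using sderiv_Hom[OF f i] sderiv_Hom[OF g i] i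
      by (simp add: summand_def sderiv_add[OF f g i] ev_add M.ract_add)
  qed
  then show ?thesis
    unfolding chain_def using summand_closed[OF f] summand_closed[OF g] by (simp add: M.grp.finsum_addf)
qed

text \<open>Both \<open>f \<mapsto> D(f(a))\<close> and \<open>f \<mapsto> \<Sum> u\<^sub>i (\<partial>\<^sub>i f)(a)\<close> are derivations along the evaluation at \<open>a\<close>, hence so is their
  difference.  All right actions are rewritten as left actions with Koszul signs.\<close>

lemma chain_mult:
  assumes f: "f \<in> Hom S X (sobj q)" and g: "g \<in> Hom S X (sobj r)"
  shows "chain X a (q + r) (act (Free_ring X) q r f g) =
    act M q r (mor A f a) (chain X a r g) \<oplus>\<^bsub>part M (q + r)\<^esub>
    ksign (part M (q + r)) (q * r) (act M r q (mor A g a) (chain X a q f))"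
proof -
  let ?P = "part M (q + r)"
  let ?l = "\<lambda>v. act M q r (mor A f a) (summand X a r g v)"
    and ?w = "\<lambda>v. act M r q (mor A g a) (summand X a q f v)"
  let ?r = "\<lambda>v. ksign ?P (q * r) (?w v)"
  have fa: "mor A f a \<in> ob A (sobj q)" and ga: "mor A g a \<in> ob A (sobj r)" using f g by auto
  have l: "?l \<in> vars X \<rightarrow> carrier ?P" and r0: "?w \<in> vars X \<rightarrow> carrier ?P"
    using fa ga summand_closed[OF f] summand_closed[OF g] by (auto intro!: M.act_closed simp: add.commute)
  then have r: "?r \<in> vars X \<rightarrow> carrier ?P" by (intro Pi_I M.grp.ksign_closed) blast
  have "chain X a (q + r) (act (Free_ring X) q r f g) = finsum ?P (\<lambda>v. ?l v \<oplus>\<^bsub>?P\<^esub> ?r v) (vars X)"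
    unfolding chain_def
  proof (rule M.grp.finsum_cong'[OF HOL.refl])
    show "(\<lambda>v. ?l v \<oplus>\<^bsub>?P\<^esub> ?r v) \<in> vars X \<rightarrow> carrier ?P"
      using l r by (intro Pi_I M.grp.a_closed; blast)
    fix v assume v: "v \<in> vars X"
    then have rv: "?r v \<in> carrier ?P" and lv: "?l v \<in> carrier ?P" using l r by blast+
    obtain p i where v_eq [simp]: "v = (p, i)" by (cases v)
    have i: "i < X p" using v by (simp add: in_vars)
    let ?u = "D p (mor A (prj S X p i) a)"
      and ?df = "mor A (sderiv S X q p i f) a" and ?dg = "mor A (sderiv S X r p i g) a"
    note d = sderiv_Hom[OF f i] sderiv_Hom[OF g i]
    have df: "?df \<in> ob A (sobj (p + q))" and dg: "?dg \<in> ob A (sobj (p + r))" using d by auto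
    let ?B = "part (sharp S A) (p + (q + r))"
    let ?t1 = "act (sharp S A) (p + q) r ?df (mor A g a)"
      and ?t2 = "ksign ?B (p * q) (act (sharp S A) q (p + r) (mor A f a) ?dg)"
    have t: "?t1 \<in> carrier ?B" "act (sharp S A) q (p + r) (mor A f a) ?dg \<in> carrier ?B"
      using df dg fa ga by (simp_all add: act_ob add.assoc add.left_commute)
    have h: "act (Free_ring X) (p + q) r (sderiv S X q p i f) g \<in> Hom S X (sobj (p + (q + r)))"
      "act (Free_ring X) q (p + r) f (sderiv S X r p i g) \<in> Hom S X (sobj (p + (q + r)))"
      using d f g by (auto intro!: act_Hom simp: add.assoc add.left_commute)
    have "mor A (sderiv S X (q + r) p i (act (Free_ring X) q r f g)) a = ?t1 \<oplus>\<^bsub>?B\<^esub> ?t2"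
      using h d f g by (simp add: sderiv_mult[OF f g i] ev_add ev_ksign ev_act[OF HOL.refl])
    then have "summand X a (q + r) (act (Free_ring X) q r f g) v = ract M p (p + (q + r)) ?u (?t1 \<oplus>\<^bsub>?B\<^esub> ?t2)"
      by (simp add: summand_def)
    also have "\<dots> = ract M p (p + (q + r)) ?u ?t1 \<oplus>\<^bsub>?P\<^esub> ract M p (p + (q + r)) ?u ?t2"
      using t A.grp.ksign_closed[OF t(2)] i by (intro M.ract_add) auto
    also have "\<dots> = ?r v \<oplus>\<^bsub>?P\<^esub> ?l v"
      using M.ract_mult_left[of ?u p ?df q "mor A g a" r] M.ract_mult_right[of ?u p "mor A f a" q ?dg r]
        df dg fa ga i by (simp add: summand_def)
    also have "\<dots> = ?l v \<oplus>\<^bsub>?P\<^esub> ?r v" using rv lv by (rule M.grp.a_comm)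
    finally show "summand X a (q + r) (act (Free_ring X) q r f g) v = ?l v \<oplus>\<^bsub>?P\<^esub> ?r v" .
  qed
  also have "\<dots> = finsum ?P ?l (vars X) \<oplus>\<^bsub>?P\<^esub> finsum ?P ?r (vars X)"
    using l r by (rule M.grp.finsum_addf)
  also have "finsum ?P ?l (vars X) = act M q r (mor A f a) (chain X a r g)"
    unfolding chain_def using fa summand_closed[OF g] by (intro M.act_finsum[symmetric]) auto
  also have "finsum ?P ?r (vars X) = ksign ?P (q * r) (finsum ?P ?w (vars X))"
    using r0 by (rule M.grp.ksign_finsum[symmetric])
  also have "finsum ?P ?w (vars X) = act M r q (mor A g a) (chain X a q f)"
    unfolding chain_def using ga summand_closed[OF f] by (intro M.act_finsum[symmetric]) (auto simp: add.commute)
  finally show ?thesis .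
qed

lemma defect_closed [simp]: "f \<in> Hom S X (sobj q) \<Longrightarrow> defect X a q f \<in> carrier (part M q)"
  unfolding defect_def by (intro M.grp.minus_closed D_closed ev_ob chain_closed)

lemma defect_add:
  "f \<in> Hom S X (sobj q) \<Longrightarrow> g \<in> Hom S X (sobj q) \<Longrightarrow>
    defect X a q (f \<oplus>\<^bsub>part (Free_ring X) q\<^esub> g) = defect X a q f \<oplus>\<^bsub>part M q\<^esub> defect X a q g"
  by (simp add: defect_def ev_add D_add chain_add M.grp.add_minus_add D_closed)

lemma defect_additive: "additive_on (part (Free_ring X) q) (part M q) (defect X a q)"
  unfolding additive_on_def by (simp add: defect_add)

lemma defect_mult:
  assumes f: "f \<in> Hom S X (sobj q)" and g: "g \<in> Hom S X (sobj r)"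
  shows "defect X a (q + r) (act (Free_ring X) q r f g) =
    act M q r (mor A f a) (defect X a r g) \<oplus>\<^bsub>part M (q + r)\<^esub>
    ksign (part M (q + r)) (q * r) (act M r q (mor A g a) (defect X a q f))"
proof -
  let ?P = "part M (q + r)"
  have fa: "mor A f a \<in> ob A (sobj q)" and ga: "mor A g a \<in> ob A (sobj r)" using f g by auto
  note d = D_closed[OF fa] D_closed[OF ga] chain_closed[OF f] chain_closed[OF g]
  have "act M q r (mor A f a) (defect X a r g) =
      act M q r (mor A f a) (D r (mor A g a)) \<ominus>\<^bsub>?P\<^esub> act M q r (mor A f a) (chain X a r g)"
    unfolding defect_def using fa d by (intro M.act_minus) auto
  moreover have "ksign ?P (q * r) (act M r q (mor A g a) (defect X a q f)) =
      ksign ?P (q * r) (act M r q (mor A g a) (D q (mor A f a))) \<ominus>\<^bsub>?P\<^esub>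
      ksign ?P (q * r) (act M r q (mor A g a) (chain X a q f))"
    unfolding defect_def using ga d M.act_minus[of "q + r" r q "mor A g a" "D q (mor A f a)" "chain X a q f"]
    by (simp add: M.grp.ksign_minus add.commute)
  ultimately show ?thesis
    using fa ga d f g
    by (simp add: defect_def[of _ _ "q + r"] ev_act[OF HOL.refl] D_mult chain_mult M.grp.add_minus_add add.commute)
qed

lemma defect_cst: "k \<in> Hom S zobj (sobj q) \<Longrightarrow> defect X a q (cst (Free_ring X) q k) = \<zero>\<^bsub>part M q\<^esub>"
  by (simp add: defect_def ev_cst D_cst chain_eq_zero sderiv_cst)

lemma defect_prj:
  assumes j: "j < X r"
  shows "defect X a r (prj S X r j) = \<zero>\<^bsub>part M r\<^esub>"
proof -
  let ?u = "D r (mor A (prj S X r j) a)"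
  have "chain X a r (prj S X r j) = finsum (part M r) (\<lambda>v. if (r, j) = v then ?u else \<zero>\<^bsub>part M r\<^esub>) (vars X)"
    unfolding chain_def
  proof (rule M.grp.finsum_cong'[OF HOL.refl])
    show "(\<lambda>v. if (r, j) = v then ?u else \<zero>\<^bsub>part M r\<^esub>) \<in> vars X \<rightarrow> carrier (part M r)" using j by auto
    fix v assume v: "v \<in> vars X"
    obtain p i where v_eq [simp]: "v = (p, i)" by (cases v)
    have i: "i < X p" using v by (simp add: in_vars)
    show "summand X a r (prj S X r j) v = (if (r, j) = v then ?u else \<zero>\<^bsub>part M r\<^esub>)"
    proof (cases "r = p \<and> j = i")
      case True
      then show ?thesis using i by (simp add: summand_def sderiv_prj_same ev_unt ract_def)
    next
      case False
      then show ?thesis using i by (auto simp: summand_def sderiv_prj_other[OF j i] ev_zero)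
    qed
  qed
  also have "\<dots> = ?u"
    using j M.grp.finsum_singleton[of "(r, j)" "vars X" "\<lambda>_. ?u"] by (simp add: in_vars)
  finally show ?thesis using j by (simp add: defect_def)
qed

end

section \<open>The defect vanishes in Weil algebras\<close>

text \<open>Let \<open>k\<close> be the \<open>K\<close>-point below the given \<open>W\<close>-point.  By Hadamard's lemma \<open>f\<close> differs from \<open>f\<close> with \<open>x\<^sub>i\<close> replaced by
  \<open>k\<^sub>i\<close> by some \<open>(x\<^sub>i - k\<^sub>i) g\<close>.  The defect is a derivation that vanishes on \<open>x\<^sub>i - k\<^sub>i\<close>, so it multiplies the defect of \<open>g\<close>
  by the value \<open>n\<^sub>i\<close> of \<open>x\<^sub>i - k\<^sub>i\<close>, which lies in the nilpotent kernel of \<open>W\<close> over \<open>K\<close>.  If all products of \<open>r + 1\<close> elements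
  of the kernel kill the defects of all functions, a product of \<open>r\<close> elements therefore does not see the replacement
  of a variable; after the replacement of all variables \<open>f\<close> is a constant, whose defect is zero.  For large \<open>r\<close>
  the products themselves vanish, and going down to \<open>r = 0\<close> gives the claim.  The sign in the assumption on \<open>\<psi>\<close>
  is that of the parity shift, so that copies of \<open>A\<close> and of \<open>\<Pi>A\<close> are covered by one statement.\<close>

lemma defect_killed:
  fixes W :: "('f, 'w) salg"
  assumes a: "a \<in> ob A X"
    and W: "s_algebra S W" and weil: "weil_alg (ground S) (sharp S W)" and \<phi>: "salg_hom S A W \<phi>"
    and \<psi>: "\<And>q. additive_on (part M q) (part (sharp S W) (q + s)) (\<psi> q)"
    and \<psi>_act: "\<And>p q b m. b \<in> ob A (sobj p) \<Longrightarrow> m \<in> carrier (part M q) \<Longrightarrow>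
      \<psi> (p + q) (act M p q b m) = ksign (part (sharp S W) (p + q + s)) (p * s)
        (act (sharp S W) p (q + s) (\<phi> (sobj p) b) (\<psi> q m))"
    and f: "f \<in> Hom S X (sobj q)"
  shows "\<psi> q (defect X a q f) = \<zero>\<^bsub>part (sharp S W) (q + s)\<^esub>"
proof -
  let ?W = "sharp S W"
  interpret W: super_module ?W ?W by (rule sharp_module[OF W])
  note \<psi>_closed = additive_on_closed[OF M.grp W.grp \<psi>] and \<psi>_zero = additive_on_zero[OF M.grp W.grp \<psi>]
    and \<psi>_add = additive_on_add[OF M.grp W.grp \<psi>]
  note \<phi>_additive = hom_additive[OF A W \<phi>]
  obtain h where h: "is_super_alg_hom (ground S) ?W (ground S) h" and nil: "nilpotent_kernel ?W (ground S) h"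
    using weil unfolding weil_alg_def by blast
  have h_closed: "h p w \<in> Hom S zobj (sobj p)" if "w \<in> ob W (sobj p)" for p w
    using h that unfolding is_super_alg_hom_def is_super_ring_hom_def by simp
  have h_additive: "additive_on (part ?W p) (part (Free_ring zobj) p) (h p)" for p
    using h unfolding is_super_alg_hom_def is_super_ring_hom_def additive_on_def ground_eq by (elim conjE) blast
  have h_cst: "h p (cst ?W p c) = c" if "c \<in> Hom S zobj (sobj p)" for p c
    using h that ground_cst[OF that] unfolding is_super_alg_hom_def by simp
  define ker where "ker xs \<longleftrightarrow> (\<forall>(p, w)\<in>set xs. w \<in> carrier (part ?W p) \<and> h p w = \<zero>\<^bsub>part (ground S) p\<^esub>)"
    for xs :: "(bit \<times> 'w) list"
  obtain N where N: "\<And>xs. length xs = N \<Longrightarrow> ker xs \<Longrightarrow> snd (sprod ?W xs) = \<zero>\<^bsub>part ?W (fst (sprod ?W xs))\<^esub>"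
    using nil unfolding nilpotent_kernel_def ker_def by blast
  have sprod_closed: "ker xs \<Longrightarrow> snd (sprod ?W xs) \<in> carrier (part ?W (fst (sprod ?W xs)))" for xs
  proof (induction xs)
    case (Cons x xs)
    then show ?case by (cases x) (simp add: ker_def W.act_closed[unfolded sharp_carrier])
  qed (simp add: W.unt_closed[unfolded sharp_carrier])

  \<comment> \<open>the coordinates of the \<open>K\<close>-valued point under the given one\<close>
  define k where "k p i = h p (\<phi> (sobj p) (mor A (prj S X p i) a))" for p i
  have coord: "mor A (prj S X p i) a \<in> ob A (sobj p)" if "i < X p" for p i
    using that by (intro ev_ob[OF a] prj_Hom)
  have k: "k p i \<in> Hom S zobj (sobj p)" if "i < X p" for p i
    unfolding k_def using that by (intro h_closed hom_ob[OF \<phi>] coord)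
  let ?b = "\<lambda>p i. prj S X p i \<ominus>\<^bsub>part (Free_ring X) p\<^esub> cst (Free_ring X) p (k p i)"
  let ?n = "\<lambda>p i. \<phi> (sobj p) (mor A (?b p i) a)"
  have b: "?b p i \<in> Hom S X (sobj p)" if "i < X p" for p i
    using that by (intro minus_Hom prj_Hom cst_Hom k)
  have b_defect: "defect X a p (?b p i) = \<zero>\<^bsub>part M p\<^esub>" if i: "i < X p" for p i
    using additive_on_minus[OF F.grp M.grp defect_additive[OF a, of p], of "prj S X p i" "cst (Free_ring X) p (k p i)"]
      cst_Hom[of X k, OF k i] i
    by (simp add: prj_Hom defect_prj[OF a] defect_cst[OF a k])
  have n: "?n p i \<in> ob W (sobj p)" "h p (?n p i) = \<zero>\<^bsub>part (ground S) p\<^esub>" if i: "i < X p" for p i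
  proof -
    show "?n p i \<in> ob W (sobj p)" by (intro hom_ob[OF \<phi>] ev_ob[OF a] b i)
    note c = cst_closed[OF A k[OF i]] and cW = cst_closed[OF W k[OF i]] and x = coord[OF i]
    have "mor A (?b p i) a = mor A (prj S X p i) a \<ominus>\<^bsub>part (sharp S A) p\<^esub> cst (sharp S A) p (k p i)"
      using cst_Hom[of X k, OF k i] i by (simp add: ev_minus[OF a] prj_Hom ev_cst[OF a k])
    also have "\<phi> (sobj p) \<dots> = \<phi> (sobj p) (mor A (prj S X p i) a) \<ominus>\<^bsub>part ?W p\<^esub> cst ?W p (k p i)"
      using x c hom_cst[OF A W \<phi> k[OF i]] by (simp add: additive_on_minus[OF A.grp W.grp \<phi>_additive])
    also have "h p \<dots> = k p i \<ominus>\<^bsub>part (Free_ring zobj) p\<^esub> k p i"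
      using hom_ob[OF \<phi> x] cW
      by (simp add: additive_on_minus[OF W.grp F.grp h_additive] h_cst[OF k[OF i]] flip: k_def)
    finally show "h p (?n p i) = \<zero>\<^bsub>part (ground S) p\<^esub>"
      using k[OF i] by (simp add: ground_eq)
  qed

  \<comment> \<open>descent on the number \<open>N - r\<close> of factors\<close>
  have "\<forall>xs q f. length xs + r = N \<longrightarrow> ker xs \<longrightarrow> f \<in> Hom S X (sobj q) \<longrightarrow>
      act ?W (fst (sprod ?W xs)) (q + s) (snd (sprod ?W xs)) (\<psi> q (defect X a q f)) =
      \<zero>\<^bsub>part ?W (fst (sprod ?W xs) + (q + s))\<^esub>" for r
  proof (induction r)
    case 0
    then show ?case using N \<psi>_closed defect_closed[OF a] by auto
  next
    case (Suc r)
    show ?case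
    proof (intro allI impI)
      fix xs q f
      assume len: "length xs + Suc r = N" and xs: "ker xs" and f: "f \<in> Hom S X (sobj q)"
      let ?P = "fst (sprod ?W xs)" and ?\<pi> = "snd (sprod ?W xs)"
      note \<pi> = sprod_closed[OF xs]
      \<comment> \<open>\<open>Z f\<close>: the given product kills the defect of \<open>f\<close>\<close>
      define Z where "Z f \<longleftrightarrow> act ?W ?P (q + s) ?\<pi> (\<psi> q (defect X a q f)) = \<zero>\<^bsub>part ?W (?P + (q + s))\<^esub>" for f
      have step: "Z f" if f: "f \<in> Hom S X (sobj q)" and i: "i < X p"
        and Z: "Z (cmp S f (replace X p i (cst (Free_ring X) p (k p i))))" for f p i
      proof -
        let ?f = "cmp S f (replace X p i (cst (Free_ring X) p (k p i)))"
        have c: "cst (Free_ring X) p (k p i) \<in> Hom S X (sobj p)" using i by (intro cst_Hom k)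
        have f1: "?f \<in> Hom S X (sobj q)" by (rule cmp_Hom[OF replace_Hom[OF c] f])
        obtain g where g: "g \<in> Hom S X (sobj (p + q))"
          and f_eq: "f = ?f \<oplus>\<^bsub>part (Free_ring X) q\<^esub> act (Free_ring X) p (p + q) (?b p i) g"
          using hadamard[OF f c i] by blast
        let ?w = "\<psi> (p + q) (defect X a (p + q) g)"
        have w: "?w \<in> carrier (part ?W (p + q + s))" using g by (intro \<psi>_closed defect_closed[OF a])
        have bg: "act (Free_ring X) p (p + q) (?b p i) g \<in> Hom S X (sobj q)" using b[OF i] g by simp
        have "defect X a q (act (Free_ring X) p (p + q) (?b p i) g) =
            act M p (p + q) (mor A (?b p i) a) (defect X a (p + q) g)"
          using defect_mult[OF a b[OF i] g] b_defect[OF i] ev_ob[OF a b[OF i]] ev_ob[OF a g]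
            defect_closed[OF a g] by (simp add: add.commute)
        then have "\<psi> q (defect X a q (act (Free_ring X) p (p + q) (?b p i) g)) =
            ksign (part ?W (q + s)) (p * s) (act ?W p (p + q + s) (?n p i) ?w)"
          using \<psi>_act[OF ev_ob[OF a b[OF i]] defect_closed[OF a g]] by simp
        moreover have "act ?W ?P (q + s) ?\<pi> (ksign (part ?W (q + s)) (p * s) (act ?W p (p + q + s) (?n p i) ?w)) =
            \<zero>\<^bsub>part ?W (?P + (q + s))\<^esub>"
        proof -
          have "ker ((p, ?n p i) # xs)" using xs n[OF i] by (simp add: ker_def)
          then have "act ?W (p + ?P) (p + q + s) (act ?W p ?P (?n p i) ?\<pi>) ?w = \<zero>\<^bsub>part ?W (p + ?P + (p + q + s))\<^esub>"
            using Suc.IH[rule_format, of "(p, ?n p i) # xs" g "p + q"] len g by simp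
          moreover have nc: "?n p i \<in> carrier (part ?W p)" using n[OF i] by simp
          ultimately have "act ?W p (?P + (p + q + s)) (?n p i) (act ?W ?P (p + q + s) ?\<pi> ?w) =
              \<zero>\<^bsub>part ?W (?P + (q + s))\<^esub>"
            using W.act_act[OF HOL.refl nc \<pi> w] by (simp add: add.assoc add.left_commute)
          then have "act ?W ?P (q + s) ?\<pi> (act ?W p (p + q + s) (?n p i) ?w) = \<zero>\<^bsub>part ?W (?P + (q + s))\<^esub>"
            using W.act_left_commute[OF \<pi> nc w, of "q + s" "?P + (p + q + s)" "?P + (q + s)"]
            by (simp add: add.assoc add.left_commute)
          moreover have "act ?W p (p + q + s) (?n p i) ?w \<in> carrier (part ?W (q + s))"
            using nc w by (intro W.act_closed) (simp_all add: add.assoc)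
          ultimately show ?thesis
            using W.act_ksign[OF HOL.refl \<pi>] by simp
        qed
        moreover have "\<psi> q (defect X a q f) = \<psi> q (defect X a q ?f) \<oplus>\<^bsub>part ?W (q + s)\<^esub>
            \<psi> q (defect X a q (act (Free_ring X) p (p + q) (?b p i) g))"
          by (subst f_eq) (simp add: defect_add[OF a f1 bg] \<psi>_add[OF defect_closed[OF a f1] defect_closed[OF a bg]])
        ultimately show "Z f"
          using Z W.grp.l_zero[OF W.grp.zero_closed] W.act_add[OF HOL.refl \<pi> \<psi>_closed[OF defect_closed[OF a f1]] \<psi>_closed[OF defect_closed[OF a bg]]]
          unfolding Z_def by simp
      qed
      have subst: "Z f" if "finite V" "V \<subseteq> vars X" "f \<in> Hom S X (sobj q)" "Z (cmp S f (partial_subst X k V))" for V f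
        using that
      proof (induction V arbitrary: f rule: finite_induct)
        case empty
        then show ?case by (simp add: partial_subst_def tup_prj cmp_idn)
      next
        case (insert v V)
        obtain p i where v [simp]: "v = (p, i)" by (cases v)
        have i: "i < X p" using insert.prems by (simp add: in_vars)
        have ps: "partial_subst X k V \<in> Hom S X X" by (rule partial_subst_Hom[of X k, OF k])
        have c: "cst (Free_ring X) p (k p i) \<in> Hom S X (sobj p)" using i by (intro cst_Hom k)
        have "Z (cmp S (cmp S f (partial_subst X k V)) (replace X p i (cst (Free_ring X) p (k p i))))"
          using insert.prems(3) cmp_assoc[OF replace_Hom[OF c] ps insert.prems(2)]
          by (simp add: partial_subst_insert[of X k, OF k i])
        then have "Z (cmp S f (partial_subst X k V))" using cmp_Hom[OF ps insert.prems(2)] i by (rule step[rotated 2])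
        then show ?case using insert.prems insert.IH[of f] by simp
      qed
      have all: "partial_subst X k (vars X) = tup S (Free X) X (\<lambda>r j. cst (Free_ring X) r (k r j))"
        unfolding partial_subst_def by (rule tup_cong) (simp add: in_vars)
      obtain c where "c \<in> Hom S zobj (sobj q)" "cmp S f (partial_subst X k (vars X)) = cst (Free_ring X) q c"
        unfolding all using constant_arrow[of f X q k, OF f k] by blast
      then have "Z (cmp S f (partial_subst X k (vars X)))"
        using \<pi> by (simp add: Z_def defect_cst[OF a] \<psi>_zero)
      then have "Z f" by (intro subst[OF finite_vars _ f]) auto
      then show "act ?W ?P (q + s) ?\<pi> (\<psi> q (defect X a q f)) = \<zero>\<^bsub>part ?W (?P + (q + s))\<^esub>"
        unfolding Z_def .
    qed
  qed
  from this[of N, rule_format, of "[]" f q] f show ?thesis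
    using \<psi>_closed[OF defect_closed[OF a f]] by (simp add: ker_def)
qed

text \<open>In a free module an element is zero if all its coordinates are, and near-point determinacy lets the
  homomorphisms to Weil algebras detect whether a coordinate is zero.\<close>

lemma defect_zero:
  assumes near: "near_point_determined TYPE('w) S A" and free: "free_super_module (sharp S A) M I s"
    and a: "a \<in> ob A X" and f: "f \<in> Hom S X (sobj q)"
  shows "defect X a q f = \<zero>\<^bsub>part M q\<^esub>"
proof -
  let ?N = "\<lambda>i. if s i = 0 then regular_module (sharp S A) else parity_shift (regular_module (sharp S A))"
  let ?B = "sharp S A"
  obtain h where h: "super_module_iso ?B M (direct_sum I ?N) h"
    using free unfolding free_super_module_def by blast
  \<comment> \<open>both kinds of summands in one formula, with the shift \<open>s i\<close> of the parity\<close>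
  have part_N: "part (?N i) p = part ?B (p + s i)" for i p
    by (cases "s i") (simp_all add: regular_module_def parity_shift_def)
  have act_N: "act (?N i) p q b m = ksign (part ?B (p + q + s i)) (p * s i) (act ?B p (q + s i) b m)" for i p q b m
    by (cases "s i") (simp_all add: regular_module_def parity_shift_def)
  have bij: "bij_betw (h p) (carrier (part M p)) (carrier (part (direct_sum I ?N) p))" for p
    using h unfolding super_module_iso_def by blast
  have h_add: "h p (m \<oplus>\<^bsub>part M p\<^esub> n) = h p m \<oplus>\<^bsub>part (direct_sum I ?N) p\<^esub> h p n"
    if "m \<in> carrier (part M p)" "n \<in> carrier (part M p)" for p m n
    using h that unfolding super_module_iso_def by blast
  have h_act: "h (p + q) (act M p q b m) = act (direct_sum I ?N) p q b (h q m)"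
    if "b \<in> ob A (sobj p)" "m \<in> carrier (part M q)" for p q b m
    using h that unfolding super_module_iso_def by simp
  have h_ext: "h p m \<in> (\<Pi>\<^sub>E i\<in>I. ob A (sobj (p + s i)))" if "m \<in> carrier (part M p)" for p m
  proof -
    have "h p m \<in> carrier (part (direct_sum I ?N) p)" using bij that by (rule bij_betwE[THEN bspec])
    then show ?thesis unfolding direct_sum_def by (simp add: part_N)
  qed
  have comp: "additive_on (part M p) (part ?B (p + s i)) (\<lambda>m. h p m i)" if i: "i \<in> I" for p i
    unfolding additive_on_def using i h_ext h_add by (auto simp: direct_sum_def part_N)
  have "h q (defect X a q f) i = h q \<zero>\<^bsub>part M q\<^esub> i" if i: "i \<in> I" for i
  proof (rule ccontr)
    let ?e = "h q (defect X a q f) i" and ?o = "\<zero>\<^bsub>part ?B (q + s i)\<^esub>"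
    assume ne: "?e \<noteq> h q \<zero>\<^bsub>part M q\<^esub> i"
    have o: "h q \<zero>\<^bsub>part M q\<^esub> i = ?o" by (rule additive_on_zero[OF M.grp A.grp comp[OF i]])
    have "?e \<in> ob A (sobj (q + s i))" "?o \<in> ob A (sobj (q + s i))"
      using additive_on_closed[OF M.grp A.grp comp[OF i] defect_closed[OF a f]] A.grp.zero_closed[of "q + s i"]
      by simp_all
    with ne o obtain W :: "('f, 'w) salg" and \<phi>
      where W: "s_algebra S W" "weil_alg (ground S) (sharp S W)" and \<phi>: "salg_hom S A W \<phi>"
        and sep: "\<phi> (sobj (q + s i)) ?e \<noteq> \<phi> (sobj (q + s i)) ?o"
      using near unfolding near_point_determined_def by metis
    interpret W: super_module "sharp S W" "sharp S W" by (rule sharp_module[OF W(1)])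
    note \<phi>_additive = hom_additive[OF A W(1) \<phi>]
    have "\<phi> (sobj (q + s i)) ?e = \<zero>\<^bsub>part (sharp S W) (q + s i)\<^esub>"
    proof (rule defect_killed[OF a W \<phi> _ _ f, where s = "s i" and \<psi> = "\<lambda>q m. \<phi> (sobj (q + s i)) (h q m i)"])
      fix p
      show "additive_on (part M p) (part (sharp S W) (p + s i)) (\<lambda>m. \<phi> (sobj (p + s i)) (h p m i))"
        using comp[OF i, of p] \<phi>_additive[of "p + s i"] unfolding additive_on_def by (auto simp: Pi_def)
    next
      fix p r b m assume b: "b \<in> ob A (sobj p)" and m: "m \<in> carrier (part M r)"
      have hm: "h r m i \<in> ob A (sobj (r + s i))" using h_ext[OF m] i by auto
      have bm: "act ?B p (r + s i) b (h r m i) \<in> carrier (part ?B (p + r + s i))"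
        using b hm by (intro A.act_closed) (simp_all add: add.assoc)
      have "h (p + r) (act M p r b m) i = ksign (part ?B (p + r + s i)) (p * s i) (act ?B p (r + s i) b (h r m i))"
        unfolding h_act[OF b m] using i by (simp add: direct_sum_def act_N)
      then show "\<phi> (sobj (p + r + s i)) (h (p + r) (act M p r b m) i) =
          ksign (part (sharp S W) (p + r + s i)) (p * s i)
            (act (sharp S W) p (r + s i) (\<phi> (sobj p) b) (\<phi> (sobj (r + s i)) (h r m i)))"
        using additive_on_ksign[OF A.grp W.grp \<phi>_additive bm] hom_act[OF A W(1) \<phi> b hm, of "p + r + s i"]
        by (simp add: add.assoc)
    qed
    then show False using sep additive_on_zero[OF A.grp W.grp \<phi>_additive] by simp
  qed
  then have "h q (defect X a q f) = h q \<zero>\<^bsub>part M q\<^esub>"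
    using h_ext[OF defect_closed[OF a f]] h_ext[OF M.grp.zero_closed] by (intro PiE_ext) auto
  then show ?thesis
    using bij[of q] defect_closed[OF a f] M.grp.zero_closed unfolding bij_betw_def inj_on_def by blast
qed

end

theorem proposition2p17:
  fixes S :: "'f super_theory"
    and A :: "('f, 'a) salg"
    and M :: "('a, 'm) super_module"
    and I :: "'i set"
    and s :: "'i \<Rightarrow> bit"
    and D :: "bit \<Rightarrow> 'a \<Rightarrow> 'm"
  assumes "super_fermat_theory S"
    and "s_algebra S A"
    and "near_point_determined TYPE('w) S A"
    and "free_super_module (sharp S A) M I s"
    and "alg_derivation (ground S) (sharp S A) M D"
  shows "salg_derivation S A M D"
proof -
  interpret derivation S A M D
  proof
    show "lawvere_theory S" "theory_morphism SCom S (from_SCom S)"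
      using assms(1) unfolding super_fermat_theory_def by blast+
    show "is_super_module (sharp S A) M" using assms(4) unfolding free_super_module_def by blast
  qed (use assms in auto)
  have chain_rule: "D q (mor A f t) = chain X t q f" if t: "t \<in> ob A X" and f: "f \<in> Hom S X (sobj q)" for X t q f
    using defect_zero[OF assms(3,4) t f] M.grp.minus_eq_zero[OF D_closed[OF ev_ob[OF t f]] chain_closed[OF t f]]
    unfolding defect_def by blast
  show ?thesis
    unfolding salg_derivation_def salg_hom_def
  proof (intro conjI allI ballI)
    fix X t assume t: "t \<in> ob A X"
    then show "eps_section S A D X t \<in> ob (square_zero S A M) X"
      by (auto simp: eps_section_def square_zero_def)
  next
    fix X Y f t assume f: "f \<in> Hom S X Y" and t: "t \<in> ob A X"
    \<comment> \<open>the epsilon component of number \<open>(q, k)\<close> is the chain rule for the component \<open>(q, k)\<close> of \<open>f\<close>\<close>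
    have "D q (mor A (prj S Y q k) (mor A f t)) =
      finsum (part M q) (\<lambda>(p, i). ract M p (p + q) ((\<lambda>i\<in>{..<X p}. D p (mor A (prj S X p i) t)) i)
               (mor A (sderiv S X q p i (cmp S (prj S Y q k) f)) t))
            (SIGMA p:{0, 1}. {..<X p})" if k: "k < Y q" for q k
    proof -
      have g: "cmp S (prj S Y q k) f \<in> Hom S X (sobj q)" using k by (intro cmp_Hom[OF f] prj_Hom)
      have "D q (mor A (prj S Y q k) (mor A f t)) = chain X t q (cmp S (prj S Y q k) f)"
        using chain_rule[OF t g] mor_cmp[OF A f prj_Hom[of k Y q, OF k] t] by simp
      also have "\<dots> = finsum (part M q) (\<lambda>(p, i). ract M p (p + q) ((\<lambda>i\<in>{..<X p}. D p (mor A (prj S X p i) t)) i)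
               (mor A (sderiv S X q p i (cmp S (prj S Y q k) f)) t)) (vars X)"
        unfolding chain_def using summand_closed[OF t g]
        by (intro M.grp.finsum_cong'[OF HOL.refl, symmetric]) (auto simp: summand_def in_vars)
      finally show ?thesis unfolding vars_def .
    qed
    then show "eps_section S A D Y (mor A f t) = mor (square_zero S A M) f (eps_section S A D X t)"
      by (auto simp: eps_section_def square_zero_def Hom_src[OF f] Hom_tgt[OF f] intro!: ext restrict_ext)
  qed
qed

end
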